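(* Let $H$ be a complex Hilbert space, let $I\subseteq\mathbb{R}$ be an interval, let $S\subseteq B(H)_{sa}$ be an invex set with respect to a map $\eta:S\times S\to B(H)_{sa}$, and suppose that $\eta$ satisfies condition (C). If for every $A,B\in S$ with the spectra of $A$ and $V:=A+\eta(B,A)$ in $I$ the function $f:I\to\mathbb{R}$ is operator preinvex with respect to $\eta$ for operators in the $\eta$-path $P_{AV}$, and $k,p$ are positive integers, then (for such $A,B$) the following inequalities hold in the operator order of $B(H)$: $$f\left(A+\tfrac12\eta(B,A)\right)\le\frac{1}{k^p}\sum_{i=0}^{k^p-1}f\left(A+\frac{2i+1}{2k^p}\eta(B,A)\right)\le\int_0^1 f(A+t\eta(B,A))\,dt$$ $$\le\frac{1}{2k^p}\sum_{i=0}^{k^p-1}\left[f\left(A+\frac{i+1}{k^p}\eta(B,A)\right)+f\left(A+\frac{i}{k^p}\eta(B,A)\right)\right]\le\frac{f(A)+f(B)}{2}.$$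
   Context: $B(H)$ is the algebra of bounded linear operators on $H$ and $B(H)_{sa}$ the real vector space of bounded selfadjoint operators. For selfadjoint $A,B$, $A\le B$ means $\langle Ax,x\rangle\le\langle Bx,x\rangle$ for all $x\in H$ (operator order). For selfadjoint $A$ and $f$ continuous on the spectrum of $A$, $f(A)$ is given by the continuous functional calculus. The integral is the integral of a continuous operator-valued function. Invex set: $S$ is invex with respect to $\eta:S\times S\to B(H)_{sa}$ if $Y+t\eta(X,Y)\in S$ for all $X,Y\in S$ and $t\in[0,1]$. Condition (C): for all $X,Y\in S$ and $t\in[0,1]$, $\eta(Y,Y+t\eta(X,Y))=-t\,\eta(X,Y)$ and $\eta(X,Y+t\eta(X,Y))=(1-t)\,\eta(X,Y)$. $\eta$-path: for $A,B\in S$ and $V=A+\eta(B,A)$, $P_{AV}=\{A+t\eta(B,A):t\in[0,1]\}$. Operator preinvex: for a set $T$ of operators (here $T=P_{AV}$), a continuous $f:I\to\mathbb{R}$ is operator preinvex on $I$ with respect to $\eta$ for operators in $T$ if $f(Y+t\eta(X,Y))\le(1-t)f(Y)+tf(X)$ in the operator order, for all $t\in[0,1]$ and all $X,Y\in T$ whose spectra are contained in $I$.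
   Formalization: The last inequality, false as stated (η=0, f(x)=x, A=5, B=0), is proved assuming Sp(B)⊆I and f(A+tη(B,A)) ≤ (1−t)f(A)+tf(B) for t in [0,1]; without these the bound (f(A)+f(V))/2 is proved instead. *)

theory Defs
  imports "HOL-Analysis.Analysis"
begin

text \<open>A complex Hilbert space. The real inner product, from which norm and topology are derived,
  is the real part of the complex one; hence \<open>norm x ^ 2 = cinner x x\<close>.\<close>

class complex_hilbert_space = real_inner + banach +
  fixes scaleC :: "complex \<Rightarrow> 'a \<Rightarrow> 'a" (infixr "*\<^sub>C" 75)
    and cinner :: "'a \<Rightarrow> 'a \<Rightarrow> complex"
  assumes scaleC_add_right: "c *\<^sub>C (x + y) = c *\<^sub>C x + c *\<^sub>C y"
    and scaleC_add_left: "(c + d) *\<^sub>C x = c *\<^sub>C x + d *\<^sub>C x"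
    and scaleC_scaleC: "c *\<^sub>C (d *\<^sub>C x) = (c * d) *\<^sub>C x"
    and scaleR_scaleC: "r *\<^sub>R x = complex_of_real r *\<^sub>C x"
    and cinner_commute: "cinner x y = cnj (cinner y x)"
    and cinner_add_left: "cinner (x + y) z = cinner x z + cinner y z"
    and cinner_scaleC_left: "cinner (c *\<^sub>C x) y = c * cinner x y"
    and inner_eq_Re_cinner: "x \<bullet> y = Re (cinner x y)"

text \<open>\<open>B(H)\<close> is the complex-linear part of the Banach space of bounded real-linear operators;
  the operator norm is the same.\<close>

type_synonym 'a operator = "'a \<Rightarrow>\<^sub>L 'a"

definition bounded_ops :: "'a::complex_hilbert_space operator set" where
  "bounded_ops = {A. \<forall>c x. blinfun_apply A (c *\<^sub>C x) = c *\<^sub>C blinfun_apply A x}"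

definition is_adjoint :: "'a::complex_hilbert_space operator \<Rightarrow> 'a operator \<Rightarrow> bool" where
  "is_adjoint A B \<longleftrightarrow> (\<forall>x y. cinner (blinfun_apply A x) y = cinner x (blinfun_apply B y))"

definition selfadjoint_ops :: "'a::complex_hilbert_space operator set" where
  "selfadjoint_ops = {A \<in> bounded_ops. is_adjoint A A}"

text \<open>For selfadjoint operators the two inner products below are real.\<close>

definition op_le :: "'a::complex_hilbert_space operator \<Rightarrow> 'a operator \<Rightarrow> bool"
    (infix "\<le>\<^sub>o\<^sub>p" 50) where
  "A \<le>\<^sub>o\<^sub>p B \<longleftrightarrow> (\<forall>x. Re (cinner (blinfun_apply A x) x) \<le> Re (cinner (blinfun_apply B x) x))"

definition spectrum :: "'a::complex_hilbert_space operator \<Rightarrow> complex set" where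
  "spectrum A = {z. \<not> (\<exists>B \<in> bounded_ops. \<forall>x.
     blinfun_apply B (blinfun_apply A x - z *\<^sub>C x) = x \<and>
     blinfun_apply A (blinfun_apply B x) - z *\<^sub>C blinfun_apply B x = x)}"

definition spectrum_in :: "'a::complex_hilbert_space operator \<Rightarrow> real set \<Rightarrow> bool" where
  "spectrum_in A I \<longleftrightarrow> spectrum A \<subseteq> complex_of_real ` I"

text \<open>The continuous functional calculus of \<open>A\<close>: an isometric unital star-homomorphism from
  \<open>C(spectrum A)\<close> into \<open>B(H)\<close> that maps the identity function to \<open>A\<close>. Continuous functions on the
  spectrum are represented by functions on the complex plane (isometry makes the values outside the
  spectrum irrelevant). Inserting \<open>0\<close> only matters for \<open>H = {0}\<close>, where the spectrum is empty.\<close>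

definition is_functional_calculus ::
    "'a::complex_hilbert_space operator \<Rightarrow> ((complex \<Rightarrow> complex) \<Rightarrow> 'a operator) \<Rightarrow> bool" where
  "is_functional_calculus A \<Phi> \<longleftrightarrow>
     (\<forall>g. continuous_on (spectrum A) g \<longrightarrow>
        \<Phi> g \<in> bounded_ops \<and>
        is_adjoint (\<Phi> g) (\<Phi> (\<lambda>z. cnj (g z))) \<and>
        norm (\<Phi> g) = Sup (insert 0 ((\<lambda>z. cmod (g z)) ` spectrum A)) \<and>
        (\<forall>c x. blinfun_apply (\<Phi> (\<lambda>z. c * g z)) x = c *\<^sub>C blinfun_apply (\<Phi> g) x)) \<and>
     (\<forall>g h. continuous_on (spectrum A) g \<and> continuous_on (spectrum A) h \<longrightarrow>
        \<Phi> (\<lambda>z. g z + h z) = \<Phi> g + \<Phi> h \<and>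
        \<Phi> (\<lambda>z. g z * h z) = \<Phi> g o\<^sub>L \<Phi> h) \<and>
     \<Phi> (\<lambda>z. 1) = id_blinfun \<and>
     \<Phi> (\<lambda>z. z) = A"

text \<open>\<open>f(A)\<close> for selfadjoint \<open>A\<close> and \<open>f\<close> continuous on the (real) spectrum of \<open>A\<close>; all
  functional calculi of \<open>A\<close> agree on continuous functions.\<close>

definition fun_op :: "(real \<Rightarrow> real) \<Rightarrow> 'a::complex_hilbert_space operator \<Rightarrow> 'a operator" where
  "fun_op f A = (SOME \<Phi>. is_functional_calculus A \<Phi>) (\<lambda>z. complex_of_real (f (Re z)))"

definition invex_set ::
    "('a::complex_hilbert_space operator \<Rightarrow> 'a operator \<Rightarrow> 'a operator) \<Rightarrow> 'a operator set \<Rightarrow> bool" where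
  "invex_set \<eta> S \<longleftrightarrow> (\<forall>X\<in>S. \<forall>Y\<in>S. \<forall>t\<in>{0..1}. Y + t *\<^sub>R \<eta> X Y \<in> S)"

definition condition_C ::
    "('a::complex_hilbert_space operator \<Rightarrow> 'a operator \<Rightarrow> 'a operator) \<Rightarrow> 'a operator set \<Rightarrow> bool" where
  "condition_C \<eta> S \<longleftrightarrow> (\<forall>X\<in>S. \<forall>Y\<in>S. \<forall>t\<in>{0..1}.
     \<eta> Y (Y + t *\<^sub>R \<eta> X Y) = - (t *\<^sub>R \<eta> X Y) \<and>
     \<eta> X (Y + t *\<^sub>R \<eta> X Y) = (1 - t) *\<^sub>R \<eta> X Y)"

text \<open>The path from \<open>A\<close> to \<open>V = A + \<eta> B A\<close>.\<close>

definition eta_path ::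
    "('a::complex_hilbert_space operator \<Rightarrow> 'a operator \<Rightarrow> 'a operator) \<Rightarrow> 'a operator \<Rightarrow> 'a operator
     \<Rightarrow> 'a operator set" where
  "eta_path \<eta> A B = (\<lambda>t. A + t *\<^sub>R \<eta> B A) ` {0..1}"

text \<open>The preinvexity inequality for one pair. It is separated from \<open>operator_preinvex\<close> because a
  bound by \<open>f(B)\<close> needs it for the pair \<open>(B, A)\<close>, and \<open>B\<close> need not lie on \<open>eta_path \<eta> A B\<close>:
  for \<open>\<eta> = 0\<close>, which satisfies condition (C), the path is \<open>{A}\<close> and preinvexity on it is vacuous.\<close>

definition preinvex_ineq ::
    "('a::complex_hilbert_space operator \<Rightarrow> 'a operator \<Rightarrow> 'a operator) \<Rightarrow> (real \<Rightarrow> real)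
     \<Rightarrow> 'a operator \<Rightarrow> 'a operator \<Rightarrow> bool" where
  "preinvex_ineq \<eta> f X Y \<longleftrightarrow> (\<forall>t\<in>{0..1}.
     fun_op f (Y + t *\<^sub>R \<eta> X Y) \<le>\<^sub>o\<^sub>p (1 - t) *\<^sub>R fun_op f Y + t *\<^sub>R fun_op f X)"

definition operator_preinvex ::
    "real set \<Rightarrow> ('a::complex_hilbert_space operator \<Rightarrow> 'a operator \<Rightarrow> 'a operator)
     \<Rightarrow> 'a operator set \<Rightarrow> (real \<Rightarrow> real) \<Rightarrow> bool" where
  "operator_preinvex I \<eta> T f \<longleftrightarrow> continuous_on I f \<and>
     (\<forall>X\<in>T. \<forall>Y\<in>T. spectrum_in X I \<and> spectrum_in Y I \<longrightarrow> preinvex_ineq \<eta> f X Y)"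

end

theory Submission
  imports Defs "HOL-Computational_Algebra.Fundamental_Theorem_Algebra"
begin

text \<open>By condition (C), \<open>\<eta>\<close> of two points of the path with parameters \<open>s\<close> and \<open>u\<close> is \<open>(s - u) \<eta> B A\<close>,
  so preinvexity makes \<open>t \<mapsto> \<langle>f(A + t \<eta> B A) x, x\<rangle>\<close> an ordinary convex function, and the claim reduces
  to the scalar Hermite-Hadamard inequality on \<open>k ^ p\<close> equal subintervals. This needs two facts from
  operator theory. The spectra along the path stay in \<open>I\<close>: a gap between the spectrum of a
  selfadjoint operator and a point on one side of it is a strict bound for the quadratic form, and
  such bounds survive convex combinations. The path \<open>t \<mapsto> f(A + t \<eta> B A)\<close> is norm continuous, hence
  integrable: it is a uniform limit of polynomials in \<open>A + t \<eta> B A\<close>. Both rest on the existence of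
  the continuous functional calculus, obtained from \<open>norm (p(A)) = max |p|\<close> on the spectrum.\<close>

section \<open>Complex scalars and adjoints\<close>

text \<open>Spectral questions become norm estimates: for selfadjoint \<open>A\<close>, the operator
  \<open>A - z\<close> is invertible exactly when it is bounded below, so a point is kept out of the
  spectrum by a lower bound instead of an explicit inverse. \<open>fun_op\<close> takes some
  functional calculus by Hilbert choice, so nothing is known about f(A) before one has been
  constructed. Afterwards the axioms force the values of any calculus on polynomials, and isometry
  bounds the distance from f(A) to p(A) by the distance from f to p on the spectrum. That estimate
  is what continuity of the path rests on. Since \<open>I\<close> may fail to be closed, the
  approximation takes place on one compact subinterval that contains all spectra along the path. The
  path ends at \<open>V = A + \<eta> B A\<close> and not at \<open>B\<close>. The scalar argument
  therefore bounds the trapezoid sum by the mean of f(A) and f(V); f(B) enters through the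
  preinvexity inequality for the pair (B, A) at \<open>t = 1\<close>, which says that f(V) is at
  most f(B).\<close>

lemma scaleC_1 [simp]: "1 *\<^sub>C x = (x::'a::complex_hilbert_space)"
  using scaleR_scaleC[of 1 x] by simp

lemma scaleC_0 [simp]: "0 *\<^sub>C x = (0::'a::complex_hilbert_space)"
  using scaleR_scaleC[of 0 x] by simp

lemma scaleC_minus1 [simp]: "(- 1) *\<^sub>C x = - (x::'a::complex_hilbert_space)"
  using scaleR_scaleC[of "-1" x] by simp

lemma scaleC_minus_left: "(- c) *\<^sub>C x = - (c *\<^sub>C (x::'a::complex_hilbert_space))"
  using scaleC_scaleC[of "-1" c x] by simp

lemma scaleC_minus_right: "c *\<^sub>C (- x) = - (c *\<^sub>C (x::'a::complex_hilbert_space))"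
  using scaleC_scaleC[of c "-1" x] by (simp add: scaleC_minus_left)

lemma scaleC_diff_right: "c *\<^sub>C (x - y) = c *\<^sub>C x - c *\<^sub>C (y::'a::complex_hilbert_space)"
  using scaleC_add_right[of c x "-y"] by (simp add: scaleC_minus_right)

lemma scaleC_diff_left: "(c - d) *\<^sub>C x = c *\<^sub>C x - d *\<^sub>C (x::'a::complex_hilbert_space)"
  using scaleC_add_left[of c "-d" x] by (simp add: scaleC_minus_left)

lemma scaleC_scaleR_commute: "c *\<^sub>C (r *\<^sub>R x) = r *\<^sub>R (c *\<^sub>C (x::'a::complex_hilbert_space))"
  by (simp add: scaleR_scaleC scaleC_scaleC mult.commute)

lemma scaleC_0_right [simp]: "c *\<^sub>C (0::'a::complex_hilbert_space) = 0"
  using scaleC_diff_right[of c 0 "0::'a"] by simp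

lemma cinner_scaleC_right:
  "cinner x (c *\<^sub>C y) = cnj c * cinner x (y::'a::complex_hilbert_space)"
  by (metis cinner_commute cinner_scaleC_left complex_cnj_mult)

lemma cinner_add_right:
  "cinner x (y + z) = cinner x y + cinner x (z::'a::complex_hilbert_space)"
  by (metis cinner_add_left cinner_commute complex_cnj_add)

lemma inner_scaleC_scaleC:
  "(c *\<^sub>C x) \<bullet> (d *\<^sub>C y) = Re (c * cnj d * cinner x (y::'a::complex_hilbert_space))"
  by (simp add: inner_eq_Re_cinner cinner_scaleC_left cinner_scaleC_right algebra_simps)

lemma inner_scaleC_left:
  "(c *\<^sub>C x) \<bullet> y = x \<bullet> (cnj c *\<^sub>C (y::'a::complex_hilbert_space))"
  by (simp add: inner_eq_Re_cinner cinner_scaleC_left cinner_scaleC_right)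

text \<open>The imaginary part is a real inner product against \<open>\<i> x\<close>, so identities
  for \<open>cinner\<close> reduce to identities for the real inner product.\<close>

lemma cinner_eq_Complex:
  "cinner x (y::'a::complex_hilbert_space) = Complex (x \<bullet> y) (- ((\<i> *\<^sub>C x) \<bullet> y))"
  by (simp add: complex_eq_iff inner_eq_Re_cinner cinner_scaleC_left)

lemma norm_scaleC: "norm (c *\<^sub>C x) = cmod c * norm (x::'a::complex_hilbert_space)"
proof -
  have "(norm (c *\<^sub>C x))\<^sup>2 = Re (c * cnj c * cinner x x)"
    by (simp only: power2_norm_eq_inner inner_scaleC_scaleC)
  also have "\<dots> = (cmod c)\<^sup>2 * (x \<bullet> x)"
    by (simp only: complex_norm_square[symmetric] inner_eq_Re_cinner Re_complex_of_real
        times_complex.simps Im_complex_of_real mult_zero_left diff_zero)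
  also have "\<dots> = (cmod c * norm x)\<^sup>2"
    by (simp add: power_mult_distrib power2_norm_eq_inner)
  finally show ?thesis
    by (simp add: power2_eq_iff_nonneg)
qed

text \<open>The operator type carries only real scalar multiplication; complex multiples and shifts
  \<open>A - z\<close> are formed by composing with or subtracting this operator.\<close>

definition scaleC_op :: "complex \<Rightarrow> 'a::complex_hilbert_space operator" where
  "scaleC_op c = Blinfun (\<lambda>x. c *\<^sub>C x)"

lemma scaleC_op_apply [simp]: "blinfun_apply (scaleC_op c) x = c *\<^sub>C x"
proof -
  have "bounded_linear (\<lambda>x::'a. c *\<^sub>C x)"
    by (rule bounded_linear_intro[where K = "cmod c"])
      (simp_all add: scaleC_add_right scaleC_scaleR_commute norm_scaleC mult.commute)
  then show ?thesis
    by (simp add: scaleC_op_def bounded_linear_Blinfun_apply)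
qed

section \<open>Complex-linear bounded operators\<close>

lemma bounded_opsI:
  "(\<And>c x. blinfun_apply A (c *\<^sub>C x) = c *\<^sub>C blinfun_apply A x) \<Longrightarrow> A \<in> bounded_ops"
  by (simp add: bounded_ops_def)

lemma bounded_opsD:
  "A \<in> bounded_ops \<Longrightarrow> blinfun_apply A (c *\<^sub>C x) = c *\<^sub>C blinfun_apply A x"
  by (simp add: bounded_ops_def)

lemma scaleC_op_bounded_ops: "scaleC_op c \<in> bounded_ops"
  by (simp add: bounded_ops_def scaleC_scaleC mult.commute)

lemma bounded_ops_0: "0 \<in> bounded_ops"
  by (simp add: bounded_ops_def)

lemma bounded_ops_add: "A \<in> bounded_ops \<Longrightarrow> B \<in> bounded_ops \<Longrightarrow> A + B \<in> bounded_ops"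
  by (simp add: bounded_ops_def blinfun.add_left scaleC_add_right)

lemma bounded_ops_scaleR: "A \<in> bounded_ops \<Longrightarrow> r *\<^sub>R A \<in> bounded_ops"
  by (simp add: bounded_ops_def blinfun.scaleR_left scaleC_scaleR_commute)

lemma bounded_ops_compose: "A \<in> bounded_ops \<Longrightarrow> B \<in> bounded_ops \<Longrightarrow> A o\<^sub>L B \<in> bounded_ops"
  by (simp add: bounded_ops_def)

lemma bounded_ops_LIMSEQ:
  assumes "\<And>n. T n \<in> bounded_ops" and "T \<longlonglongrightarrow> (U::'a::complex_hilbert_space operator)"
  shows "U \<in> bounded_ops"
proof (rule bounded_opsI)
  fix c and x :: 'a
  have 1: "(\<lambda>n. blinfun_apply (T n) y) \<longlonglongrightarrow> blinfun_apply U y" for y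
    by (intro tendsto_intros assms)
  have "(\<lambda>n. blinfun_apply (scaleC_op c) (blinfun_apply (T n) x))
      \<longlonglongrightarrow> blinfun_apply (scaleC_op c) (blinfun_apply U x)"
    by (intro tendsto_intros assms)
  then have 2: "(\<lambda>n. blinfun_apply (T n) (c *\<^sub>C x)) \<longlonglongrightarrow> c *\<^sub>C blinfun_apply U x"
    by (simp add: bounded_opsD[OF assms(1)])
  show "blinfun_apply U (c *\<^sub>C x) = c *\<^sub>C blinfun_apply U x"
    by (rule LIMSEQ_unique[OF 1 2])
qed

section \<open>Adjoints through the real inner product\<close>

lemma is_adjoint_inner: "is_adjoint A B \<Longrightarrow> blinfun_apply A x \<bullet> y = x \<bullet> blinfun_apply B y"
  by (simp add: is_adjoint_def inner_eq_Re_cinner)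

text \<open>Complex linearity of \<open>A\<close> allows the real identity to be applied to
  \<open>\<i> x\<close> as well, which recovers the imaginary part.\<close>

lemma is_adjointI_inner:
  assumes "A \<in> bounded_ops"
    and "\<And>x y. blinfun_apply A x \<bullet> y = x \<bullet> blinfun_apply B y"
  shows "is_adjoint A B"
  unfolding is_adjoint_def cinner_eq_Complex
  by (simp add: assms bounded_opsD[OF assms(1), symmetric])

lemma is_adjoint_add: "is_adjoint A B \<Longrightarrow> is_adjoint C D \<Longrightarrow> is_adjoint (A + C) (B + D)"
  by (simp add: is_adjoint_def blinfun.add_left cinner_add_left cinner_add_right)

lemma is_adjoint_compose: "is_adjoint A B \<Longrightarrow> is_adjoint C D \<Longrightarrow> is_adjoint (A o\<^sub>L C) (D o\<^sub>L B)"
  by (simp add: is_adjoint_def)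

lemma is_adjoint_scaleR: "is_adjoint A B \<Longrightarrow> is_adjoint (r *\<^sub>R A) (r *\<^sub>R B)"
  by (simp add: is_adjoint_def blinfun.scaleR_left scaleR_scaleC cinner_scaleC_left
      cinner_scaleC_right)

lemma is_adjoint_scaleC_op: "is_adjoint (scaleC_op c) (scaleC_op (cnj c))"
  by (simp add: is_adjoint_def cinner_scaleC_left cinner_scaleC_right)

lemma is_adjoint_LIMSEQ:
  assumes "\<And>n. T n \<in> bounded_ops" and "\<And>n. is_adjoint (T n) (T' n)"
    and "T \<longlonglongrightarrow> (U::'a::complex_hilbert_space operator)" and "T' \<longlonglongrightarrow> U'"
  shows "is_adjoint U U'"
proof (rule is_adjointI_inner)
  show "U \<in> bounded_ops"
    using assms by (blast intro: bounded_ops_LIMSEQ)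
  fix x y :: 'a
  have 1: "(\<lambda>n. blinfun_apply (T n) x \<bullet> y) \<longlonglongrightarrow> blinfun_apply U x \<bullet> y"
    by (intro tendsto_intros assms)
  have "(\<lambda>n. x \<bullet> blinfun_apply (T' n) y) \<longlonglongrightarrow> x \<bullet> blinfun_apply U' y"
    by (intro tendsto_intros assms)
  then have 2: "(\<lambda>n. blinfun_apply (T n) x \<bullet> y) \<longlonglongrightarrow> x \<bullet> blinfun_apply U' y"
    by (simp add: is_adjoint_inner[OF assms(2)])
  show "blinfun_apply U x \<bullet> y = x \<bullet> blinfun_apply U' y"
    by (rule LIMSEQ_unique[OF 1 2])
qed

text \<open>Cauchy-Schwarz applied to the square of the norm of \<open>B x\<close>, which is the
  inner product of \<open>A (B x)\<close> with \<open>x\<close>.\<close>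

lemma is_adjoint_norm_le:
  assumes "is_adjoint A (B::'a::complex_hilbert_space operator)"
  shows "norm B \<le> norm A"
proof (rule norm_blinfun_bound)
  fix x :: 'a
  let ?y = "blinfun_apply B x"
  have "norm ?y * norm ?y = blinfun_apply A ?y \<bullet> x"
    by (simp add: is_adjoint_inner[OF assms] flip: power2_norm_eq_inner power2_eq_square)
  also have "\<dots> \<le> norm (blinfun_apply A ?y) * norm x"
    by (rule norm_cauchy_schwarz)
  also have "\<dots> \<le> norm A * norm ?y * norm x"
    by (intro mult_right_mono norm_blinfun norm_ge_zero)
  finally have "norm ?y * norm ?y \<le> norm ?y * (norm A * norm x)"
    by (simp add: mult_ac)
  then show "norm ?y \<le> norm A * norm x"
    by (cases "norm ?y = 0") (simp_all add: mult_le_cancel_left_pos)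
qed simp

lemma selfadjoint_opsD:
  assumes "A \<in> selfadjoint_ops"
  shows "A \<in> bounded_ops" and "is_adjoint A A"
  using assms by (simp_all add: selfadjoint_ops_def)

lemma selfadjoint_ops_add_scaleR:
  "A \<in> selfadjoint_ops \<Longrightarrow> B \<in> selfadjoint_ops \<Longrightarrow> A + t *\<^sub>R B \<in> selfadjoint_ops"
  by (simp add: selfadjoint_ops_def bounded_ops_add bounded_ops_scaleR is_adjoint_add
      is_adjoint_scaleR)

section \<open>The spectrum of a selfadjoint operator\<close>

text \<open>For \<open>A - z\<close> with \<open>A\<close> selfadjoint this is equivalent to
  invertibility: the whole spectrum is approximate point spectrum. Unlike invertibility, it passes
  to compositions and to small perturbations by a direct estimate.\<close>

definition bounded_below :: "'a::complex_hilbert_space operator \<Rightarrow> bool" where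
  "bounded_below T \<longleftrightarrow> (\<exists>c>0. \<forall>x. c * norm x \<le> norm (blinfun_apply T x))"

lemma bounded_below_compose:
  assumes "bounded_below S" and "bounded_below T"
  shows "bounded_below (S o\<^sub>L T)"
proof -
  obtain c d where c: "c > 0" "\<And>x. c * norm x \<le> norm (blinfun_apply S x)"
    and d: "d > 0" "\<And>x. d * norm x \<le> norm (blinfun_apply T x)"
    using assms by (auto simp: bounded_below_def)
  have "c * d * norm x \<le> norm (blinfun_apply S (blinfun_apply T x))" for x
    using order_trans[OF mult_left_mono[OF d(2)[of x], of c] c(2)] c(1)
    by (simp add: mult.assoc)
  then show ?thesis
    using c(1) d(1) unfolding bounded_below_def
    by (intro exI[of _ "c * d"]) simp
qed

text \<open>For small \<open>a > 0\<close> the map \<open>u \<mapsto> u - a (T u - y)\<close> is a contraction; its fixed point solves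
  \<open>T u = y\<close>.\<close>

lemma coercive_surj:
  fixes T :: "'a::complex_hilbert_space operator"
  assumes c: "c > 0" and T: "\<And>x. c * (norm x)\<^sup>2 \<le> blinfun_apply T x \<bullet> x"
  shows "\<exists>u. blinfun_apply T u = y"
proof -
  \<comment> \<open>\<open>norm T\<close> alone is 0 on the zero space; adding \<open>c\<close>
    secures \<open>M > 0\<close> and \<open>c \<le> M\<close>, so the radicand in \<open>q\<close>
    lies in [0, 1).\<close>
  define M where "M = norm T + c"
  have M: "M > 0" "c \<le> M"
    using c by (simp_all add: M_def add_nonneg_pos)
  \<comment> \<open>The minimiser of \<open>1 - 2 * a * c + a^2 * M^2\<close>, which bounds the
    squared contraction factor; the minimum is the square of \<open>q\<close>.\<close>
  define a where "a = c / M\<^sup>2"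
  define q where "q = sqrt (1 - c\<^sup>2 / M\<^sup>2)"
  have a: "a > 0"
    using c M by (simp add: a_def)
  have cM: "c\<^sup>2 / M\<^sup>2 \<le> 1" "0 < c\<^sup>2 / M\<^sup>2"
    using c M by (simp_all add: power_mono)
  have q: "0 \<le> q" "q < 1" "q\<^sup>2 = 1 - c\<^sup>2 / M\<^sup>2"
    using cM by (simp_all add: q_def)
  have contr: "norm (x - a *\<^sub>R blinfun_apply T x) \<le> q * norm x" for x
  proof (rule power2_le_imp_le)
    have "norm (blinfun_apply T x) \<le> M * norm x"
      using norm_blinfun[of T x] c by (simp add: M_def algebra_simps)
        (smt (verit) mult_nonneg_nonneg norm_ge_zero)
    then have "(norm (blinfun_apply T x))\<^sup>2 \<le> M\<^sup>2 * (norm x)\<^sup>2"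
      by (metis norm_ge_zero power_mono power_mult_distrib)
    then have 1: "a\<^sup>2 * (norm (blinfun_apply T x))\<^sup>2 \<le> a\<^sup>2 * (M\<^sup>2 * (norm x)\<^sup>2)"
      by (intro mult_left_mono) simp_all
    have 2: "2 * a * (c * (norm x)\<^sup>2) \<le> 2 * a * (blinfun_apply T x \<bullet> x)"
      using a by (intro mult_left_mono T) simp
    have "(norm (x - a *\<^sub>R blinfun_apply T x))\<^sup>2
        = (norm x)\<^sup>2 - 2 * a * (blinfun_apply T x \<bullet> x) + a\<^sup>2 * (norm (blinfun_apply T x))\<^sup>2"
      unfolding power2_norm_eq_inner
      by (simp add: inner_diff_left inner_diff_right inner_commute power2_eq_square)
    also have "\<dots> \<le> (norm x)\<^sup>2 - 2 * a * (c * (norm x)\<^sup>2) + a\<^sup>2 * (M\<^sup>2 * (norm x)\<^sup>2)"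
      using 1 2 by linarith
    also have "\<dots> = (1 - c\<^sup>2 / M\<^sup>2) * (norm x)\<^sup>2"
      using M by (simp add: a_def field_simps power2_eq_square)
    finally show "(norm (x - a *\<^sub>R blinfun_apply T x))\<^sup>2 \<le> (q * norm x)\<^sup>2"
      by (simp add: q(3) power_mult_distrib)
  qed (use q in simp)
  have "\<exists>!u. u - a *\<^sub>R (blinfun_apply T u - y) = u"
  proof (rule banach_fix_type)
    show "\<forall>u v. dist (u - a *\<^sub>R (blinfun_apply T u - y))
        (v - a *\<^sub>R (blinfun_apply T v - y)) \<le> q * dist u v"
      using contr[of "u - v" for u v]
      by (simp add: dist_norm blinfun.diff_right algebra_simps)
  qed (use q in auto)
  then show ?thesis
    using a by auto
qed

text \<open>Lax-Milgram: coercivity and Cauchy-Schwarz bound \<open>T\<close> below by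
  \<open>c\<close>, which gives injectivity and the bound \<open>1 / c\<close> for the inverse.
  Linearity of the inverse is checked after applying \<open>T\<close>.\<close>

lemma coercive_inverse:
  fixes T :: "'a::complex_hilbert_space operator"
  assumes "T \<in> bounded_ops" and c: "c > 0"
    and T: "\<And>x. c * (norm x)\<^sup>2 \<le> blinfun_apply T x \<bullet> x"
  obtains W where "W \<in> bounded_ops" and "W o\<^sub>L T = id_blinfun" and "T o\<^sub>L W = id_blinfun"
proof -
  have below: "c * norm x \<le> norm (blinfun_apply T x)" for x
  proof (cases "x = 0")
    case False
    have "c * (norm x)\<^sup>2 \<le> norm (blinfun_apply T x) * norm x"
      using T norm_cauchy_schwarz order_trans by blast
    with False show ?thesis
      by (simp add: power2_eq_square flip: mult.assoc)
  qed simp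
  have inj: "x = y" if "blinfun_apply T x = blinfun_apply T y" for x y
    using below[of "x - y"] that c by (simp add: blinfun.diff_right mult_le_0_iff)
  define w where "w y = (SOME u. blinfun_apply T u = y)" for y
  have Tw: "blinfun_apply T (w y) = y" for y
    unfolding w_def by (rule someI_ex) (rule coercive_surj[OF c T])
  have wT: "w (blinfun_apply T x) = x" for x
    by (rule inj) (rule Tw)
  have "bounded_linear w"
  proof (rule bounded_linear_intro[where K = "1 / c"])
    show "norm (w y) \<le> norm y * (1 / c)" for y
      using below[of "w y"] c by (simp add: Tw field_simps)
  qed (rule inj, simp add: Tw blinfun.add_right blinfun.scaleR_right)+
  then have W: "blinfun_apply (Blinfun w) = w"
    by (rule bounded_linear_Blinfun_apply)
  show thesis
  proof
    show "Blinfun w \<in> bounded_ops"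
      by (rule bounded_opsI, rule inj) (simp add: W Tw bounded_opsD[OF assms(1)])
  qed (auto intro!: blinfun_eqI simp: W Tw wT)
qed

text \<open>With \<open>D z = A - z\<close>, the adjoint of \<open>D z\<close> is
  \<open>D (cnj z)\<close>. If \<open>D z\<close> is bounded below, \<open>D (cnj z) D z\<close> is
  coercive and has an inverse \<open>W\<close>. Then \<open>W D (cnj z)\<close> is a left inverse of
  \<open>D z\<close>, and normality of \<open>D z\<close> makes it a right inverse too.\<close>

lemma spectrum_iff_not_bounded_below:
  assumes "A \<in> selfadjoint_ops"
  shows "z \<in> spectrum A \<longleftrightarrow> \<not> bounded_below (A - scaleC_op z)"
proof -
  note A = selfadjoint_opsD[OF assms]
  define D where "D w = A - scaleC_op w" for w
  have D_apply: "blinfun_apply (D w) x = blinfun_apply A x - w *\<^sub>C x" for w x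
    by (simp add: D_def blinfun.diff_left)
  have D_bounded: "D w \<in> bounded_ops" for w
    by (rule bounded_opsI)
      (simp add: D_apply bounded_opsD[OF A(1)] scaleC_diff_right scaleC_scaleC mult.commute)
  have D_commute: "D v o\<^sub>L D w = D w o\<^sub>L D v" for v w
    by (rule blinfun_eqI)
      (simp add: D_apply bounded_opsD[OF A(1)] scaleC_diff_right scaleC_scaleC mult.commute
        blinfun.diff_right)
  have D_adjoint: "blinfun_apply (D w) x \<bullet> y = x \<bullet> blinfun_apply (D (cnj w)) y" for w x y
    by (simp add: D_apply inner_diff_left inner_diff_right is_adjoint_inner[OF A(2)]
        inner_scaleC_left)
  have "(\<exists>B\<in>bounded_ops. \<forall>x. blinfun_apply B (blinfun_apply A x - z *\<^sub>C x) = x \<and>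
      blinfun_apply A (blinfun_apply B x) - z *\<^sub>C blinfun_apply B x = x) \<longleftrightarrow> bounded_below (D z)"
    (is "?inv \<longleftrightarrow> _")
  proof
    assume ?inv
    then obtain B where B: "\<And>x. blinfun_apply B (blinfun_apply (D z) x) = x"
      by (auto simp: D_apply)
    \<comment> \<open>The summand 1 keeps the constant positive when \<open>B = 0\<close>, which
      happens on the zero space.\<close>
    have "1 / (norm B + 1) * norm x \<le> norm (blinfun_apply (D z) x)" for x
    proof -
      have "norm x \<le> norm B * norm (blinfun_apply (D z) x)"
        using norm_blinfun[of B "blinfun_apply (D z) x"] by (simp add: B)
      also have "\<dots> \<le> (norm B + 1) * norm (blinfun_apply (D z) x)"
        by (intro mult_right_mono) simp_all
      finally show ?thesis
        by (subst mult.commute) (simp add: pos_divide_le_eq add_nonneg_pos mult.commute)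
    qed
    moreover have "1 / (norm B + 1) > 0"
      by (simp add: add_nonneg_pos)
    ultimately show "bounded_below (D z)"
      unfolding bounded_below_def by blast
  next
    assume "bounded_below (D z)"
    then obtain c where c: "c > 0" "\<And>x. c * norm x \<le> norm (blinfun_apply (D z) x)"
      by (auto simp: bounded_below_def)
    let ?T = "D (cnj z) o\<^sub>L D z"
    obtain W where W: "W \<in> bounded_ops" "W o\<^sub>L ?T = id_blinfun" "?T o\<^sub>L W = id_blinfun"
    proof (rule coercive_inverse)
      show "?T \<in> bounded_ops"
        by (intro bounded_ops_compose D_bounded)
      show "c\<^sup>2 > 0"
        using c by simp
      show "c\<^sup>2 * (norm x)\<^sup>2 \<le> blinfun_apply ?T x \<bullet> x" for x
        using power_mono[OF c(2)[of x], of 2] c(1)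
        by (simp add: D_adjoint power2_norm_eq_inner power_mult_distrib)
    qed
    have assoc: "X o\<^sub>L (Y o\<^sub>L Z) = (X o\<^sub>L Y) o\<^sub>L Z" for X Y Z :: "'a operator"
      by (rule blinfun_eqI) simp
    have id: "X o\<^sub>L id_blinfun = X" "id_blinfun o\<^sub>L X = X" for X :: "'a operator"
      by (rule blinfun_eqI, simp)+
    \<comment> \<open>\<open>W\<close> commutes with \<open>D z\<close> because \<open>?T\<close>
      does: insert \<open>?T W\<close> on the right, move \<open>D z\<close> past \<open>?T\<close>,
      and cancel \<open>W ?T\<close> on the left.\<close>
    have "W o\<^sub>L D z = W o\<^sub>L (D z o\<^sub>L (?T o\<^sub>L W))"
      by (simp add: W id)
    also have "D z o\<^sub>L (?T o\<^sub>L W) = ?T o\<^sub>L (D z o\<^sub>L W)"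
      by (metis assoc D_commute)
    also have "W o\<^sub>L \<dots> = D z o\<^sub>L W"
      by (metis assoc W(2) id(2))
    finally have WD: "W o\<^sub>L D z = D z o\<^sub>L W" .
    have "(W o\<^sub>L D (cnj z)) o\<^sub>L D z = id_blinfun"
      by (metis assoc W(2))
    moreover have "D z o\<^sub>L (W o\<^sub>L D (cnj z)) = id_blinfun"
      by (metis assoc W(2) WD D_commute)
    ultimately have "blinfun_apply (W o\<^sub>L D (cnj z)) (blinfun_apply (D z) x) = x \<and>
        blinfun_apply (D z) (blinfun_apply (W o\<^sub>L D (cnj z)) x) = x" for x
      by (metis blinfun_apply_blinfun_compose blinfun_apply_id_blinfun)
    then show ?inv
      unfolding D_apply using bounded_ops_compose[OF W(1) D_bounded] by blast
  qed
  then show ?thesis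
    by (simp only: spectrum_def mem_Collect_eq D_def)
qed

text \<open>The inner product of \<open>A x\<close> with \<open>x\<close> is real, so pairing
  \<open>(A - z) x\<close> with \<open>\<i> x\<close> leaves only the contribution of
  \<open>Im z\<close>. Hence \<open>A - z\<close> is bounded below by the absolute value of
  \<open>Im z\<close>.\<close>

lemma spectrum_Im_0:
  assumes A: "A \<in> selfadjoint_ops" and z: "z \<in> spectrum A"
  shows "Im z = 0"
proof (rule ccontr)
  assume Im: "Im z \<noteq> 0"
  have "\<bar>Im z\<bar> * norm x \<le> norm (blinfun_apply (A - scaleC_op z) x)" for x
  proof (cases "x = 0")
    case False
    let ?y = "blinfun_apply A x - z *\<^sub>C x"
    have Ax: "(\<i> *\<^sub>C x) \<bullet> blinfun_apply A x = 0"
    proof -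
      have "(\<i> *\<^sub>C x) \<bullet> blinfun_apply A x = blinfun_apply A (\<i> *\<^sub>C x) \<bullet> x"
        by (rule is_adjoint_inner[OF selfadjoint_opsD(2)[OF A], symmetric])
      also have "\<dots> = - (blinfun_apply A x \<bullet> (\<i> *\<^sub>C x))"
        by (simp add: bounded_opsD[OF selfadjoint_opsD(1)[OF A]] inner_scaleC_left
            scaleC_minus_left)
      finally show ?thesis by (simp add: inner_commute)
    qed
    have x: "cinner x x = complex_of_real ((norm x)\<^sup>2)"
      using cinner_commute[of x x]
      by (simp add: complex_eq_iff power2_norm_eq_inner inner_eq_Re_cinner)
    have "\<bar>Im z\<bar> * (norm x)\<^sup>2 = \<bar>(\<i> *\<^sub>C x) \<bullet> ?y\<bar>"
      by (simp add: inner_diff_right Ax inner_scaleC_scaleC x abs_mult)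
    also have "\<dots> \<le> norm x * norm ?y"
      using Cauchy_Schwarz_ineq2[of "\<i> *\<^sub>C x" ?y] by (simp add: norm_scaleC)
    finally show ?thesis
      using False by (simp add: power2_eq_square blinfun.diff_left mult.left_commute)
  qed simp
  then have "bounded_below (A - scaleC_op z)"
    unfolding bounded_below_def using Im by (intro exI[of _ "\<bar>Im z\<bar>"]) simp
  with z show False
    by (simp add: spectrum_iff_not_bounded_below[OF A])
qed

text \<open>If \<open>A - z\<close> is bounded below by \<open>c\<close>, then \<open>A - w\<close>
  still is for every \<open>w\<close> at distance less than \<open>c\<close> from \<open>z\<close>,
  so the complement is open. If \<open>norm z > norm A\<close>, then \<open>A - z\<close> is bounded
  below by the difference.\<close>

lemma compact_spectrum:
  assumes A: "A \<in> selfadjoint_ops"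
  shows "compact (spectrum A)"
proof -
  have close: "cmod (w - z) \<ge> c"
    if "c > 0" "\<And>x. c * norm x \<le> norm (blinfun_apply (A - scaleC_op z) x)" "w \<in> spectrum A"
    for c z w
  proof (rule ccontr)
    assume w: "\<not> c \<le> cmod (w - z)"
    have "(c - cmod (w - z)) * norm x \<le> norm (blinfun_apply (A - scaleC_op w) x)" for x
    proof -
      have "blinfun_apply (A - scaleC_op z) x = blinfun_apply (A - scaleC_op w) x + (w - z) *\<^sub>C x"
        by (simp add: blinfun.diff_left scaleC_diff_left)
      then have "c * norm x \<le> norm (blinfun_apply (A - scaleC_op w) x + (w - z) *\<^sub>C x)"
        using that(2)[of x] by simp
      also have "\<dots> \<le> norm (blinfun_apply (A - scaleC_op w) x) + cmod (w - z) * norm x"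
        by (metis norm_scaleC norm_triangle_ineq)
      finally show ?thesis by (simp add: algebra_simps)
    qed
    then have "bounded_below (A - scaleC_op w)"
      unfolding bounded_below_def using w by (intro exI[of _ "c - cmod (w - z)"]) simp
    with that(3) show False
      by (simp add: spectrum_iff_not_bounded_below[OF A])
  qed
  have "closed (spectrum A)"
    unfolding closed_def open_contains_ball
  proof
    fix z assume "z \<in> - spectrum A"
    then obtain c where c: "c > 0" "\<And>x. c * norm x \<le> norm (blinfun_apply (A - scaleC_op z) x)"
      by (auto simp: spectrum_iff_not_bounded_below[OF A] bounded_below_def)
    have "ball z c \<subseteq> - spectrum A"
      using close[OF c] by (force simp: dist_norm norm_minus_commute)
    with c(1) show "\<exists>e>0. ball z e \<subseteq> - spectrum A"
      by blast
  qed
  moreover have "bounded (spectrum A)"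
  proof (rule boundedI[where B = "norm A"])
    fix z assume z: "z \<in> spectrum A"
    show "norm z \<le> norm A"
    proof (rule ccontr)
      assume less: "\<not> norm z \<le> norm A"
      have "(norm z - norm A) * norm x \<le> norm (blinfun_apply (A - scaleC_op z) x)" for x
        using norm_blinfun[of A x] norm_triangle_ineq2[of "z *\<^sub>C x" "blinfun_apply A x"]
        by (simp add: blinfun.diff_left norm_scaleC left_diff_distrib
            norm_minus_commute[of "z *\<^sub>C x"])
      then have "bounded_below (A - scaleC_op z)"
        unfolding bounded_below_def using less by (intro exI[of _ "norm z - norm A"]) simp
      with z show False
        by (simp add: spectrum_iff_not_bounded_below[OF A])
    qed
  qed
  ultimately show ?thesis
    by (simp add: compact_eq_bounded_closed)
qed

section \<open>Polynomials in an operator\<close>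

text \<open>Horner's scheme, so that facts about polynomials in \<open>A\<close> follow by induction
  along \<open>pCons\<close>.\<close>

definition op_poly :: "'a::complex_hilbert_space operator \<Rightarrow> complex poly \<Rightarrow> 'a operator" where
  "op_poly A p = fold_coeffs (\<lambda>c T. scaleC_op c + (A o\<^sub>L T)) p 0"

lemma op_poly_0 [simp]: "op_poly A 0 = 0"
  by (simp add: op_poly_def)

lemma op_poly_pCons [simp]: "op_poly A (pCons c p) = scaleC_op c + (A o\<^sub>L op_poly A p)"
\<comment> \<open>\<open>pCons 0 0\<close> is the zero polynomial, on which
  \<open>fold_coeffs\<close> performs no step.\<close>
proof (cases "p = 0 \<and> c = 0")
  case True
  then show ?thesis
    by (auto intro!: blinfun_eqI simp: blinfun.add_left)
next
  case False
  then show ?thesis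
    by (auto simp: op_poly_def)
qed

lemma op_poly_1: "op_poly A 1 = id_blinfun"
  by (rule blinfun_eqI) (simp add: one_pCons blinfun.add_left)

lemma op_poly_bounded_ops: "A \<in> bounded_ops \<Longrightarrow> op_poly A p \<in> bounded_ops"
  by (induction p)
    (simp_all add: bounded_ops_0 bounded_ops_add bounded_ops_compose scaleC_op_bounded_ops)

lemma op_poly_add: "op_poly A (p + q) = op_poly A p + op_poly A q"
proof (induction p arbitrary: q)
  case (pCons c p)
  show ?case
  proof (cases q)
    case (pCons d r)
    show ?thesis
      by (rule blinfun_eqI)
        (simp add: pCons pCons.IH blinfun.add_left blinfun.add_right scaleC_add_left)
  qed
qed simp

lemma op_poly_smult:
  assumes "A \<in> bounded_ops"
  shows "op_poly A (smult c p) = scaleC_op c o\<^sub>L op_poly A p"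
proof (induction p)
  case 0
  show ?case
    by (rule blinfun_eqI) simp
next
  case (pCons d p)
  show ?case
    by (rule blinfun_eqI)
      (simp add: pCons.IH blinfun.add_left scaleC_add_right scaleC_scaleC bounded_opsD[OF assms])
qed

lemma op_poly_diff:
  assumes "A \<in> bounded_ops"
  shows "op_poly A (p - q) = op_poly A p - op_poly A q"
proof -
  have "op_poly A (p - q) = op_poly A p + op_poly A (smult (- 1) q)"
    unfolding op_poly_add[symmetric] by simp
  also have "op_poly A (smult (- 1) q) = - op_poly A q"
    unfolding op_poly_smult[OF assms] by (rule blinfun_eqI) (simp add: blinfun.minus_left)
  finally show ?thesis by simp
qed

lemma op_poly_mult:
  assumes "A \<in> bounded_ops"
  shows "op_poly A (p * q) = op_poly A p o\<^sub>L op_poly A q"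
proof (induction p)
  case (pCons c p)
  show ?case
    by (rule blinfun_eqI)
      (simp add: pCons.IH op_poly_add op_poly_smult[OF assms] blinfun.add_left)
qed simp

lemma op_poly_linear: "op_poly A [:- z, 1:] = A - scaleC_op z"
  by (rule blinfun_eqI) (simp add: blinfun.add_left blinfun.diff_left scaleC_minus_left)

lemma is_adjoint_op_poly:
  assumes "A \<in> selfadjoint_ops"
  shows "is_adjoint (op_poly A p) (op_poly A (map_poly cnj p))"
proof (induction p)
  case 0
  show ?case
    by (simp add: is_adjoint_def cinner_eq_Complex)
next
  case (pCons c p)
  note A = selfadjoint_opsD[OF assms]
  let ?q = "op_poly A (map_poly cnj p)"
  \<comment> \<open>Taking adjoints reverses the order of composition; commutativity restores the
    Horner form.\<close>
  have "A o\<^sub>L ?q = ?q o\<^sub>L A"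
  proof -
    have 1: "op_poly A [:0, 1:] = A"
      using op_poly_linear[of A 0] by (auto intro!: blinfun_eqI simp: blinfun.diff_left)
    show ?thesis
      using op_poly_mult[OF A(1), of "[:0, 1:]" "map_poly cnj p"]
        op_poly_mult[OF A(1), of "map_poly cnj p" "[:0, 1:]"]
      unfolding 1 by (simp add: mult.commute)
  qed
  then have "is_adjoint (A o\<^sub>L op_poly A p) (A o\<^sub>L ?q)"
    using is_adjoint_compose[OF A(2) pCons.IH] by simp
  then show ?case
    using is_adjoint_add[OF is_adjoint_scaleC_op]
    by (simp add: map_poly_pCons)
qed

text \<open>One half of spectral mapping: p(A) is a composition of a nonzero scalar and factors
  \<open>A - z\<close> with \<open>z\<close> a root of \<open>p\<close>. The roots lie outside the
  spectrum, so each factor is bounded below.\<close>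

lemma op_poly_bounded_below:
  assumes A: "A \<in> selfadjoint_ops" and "p \<noteq> 0"
    and "\<And>z. z \<in> spectrum A \<Longrightarrow> poly p z \<noteq> 0"
  shows "bounded_below (op_poly A p)"
  using assms(2,3)
proof (induction "degree p" arbitrary: p)
  case 0
  then obtain c where c: "p = [:c:]" "c \<noteq> 0"
    by (metis degree_eq_zeroE pCons_0_0)
  then show ?case
    unfolding bounded_below_def
    by (intro exI[of _ "cmod c"]) (simp add: blinfun.add_left norm_scaleC)
next
  case (Suc n)
  have "\<not> constant (poly p)"
    using Suc.hyps(2) by (simp add: constant_degree)
  then obtain z where z: "poly p z = 0"
    using fundamental_theorem_of_algebra by blast
  then obtain q where q: "p = [:- z, 1:] * q"
    by (auto simp: poly_eq_0_iff_dvd)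
  have "q \<noteq> 0"
    using q Suc.prems(1) by auto
  then have "degree q = n"
    using Suc.hyps(2) unfolding q by (subst (asm) degree_mult_eq) auto
  moreover have "poly q w \<noteq> 0" if "w \<in> spectrum A" for w
    using Suc.prems(2)[OF that] by (simp add: q)
  ultimately have "bounded_below (op_poly A q)"
    using Suc.hyps(1) \<open>q \<noteq> 0\<close> by blast
  moreover have "bounded_below (A - scaleC_op z)"
    using Suc.prems(2) z spectrum_iff_not_bounded_below[OF A] by blast
  ultimately show ?case
    unfolding q op_poly_mult[OF selfadjoint_opsD(1)[OF A]] op_poly_linear
    by (rule bounded_below_compose[rotated])
qed

text \<open>The other half: if the modulus of p(z) exceeded the norm of p(A), then p(A) - p(z) would
  be bounded below by the difference. It factors through \<open>A - z\<close>, which would be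
  bounded below as well.\<close>

lemma cmod_poly_spectrum_le:
  assumes A: "A \<in> selfadjoint_ops" and z: "z \<in> spectrum A"
  shows "cmod (poly p z) \<le> norm (op_poly A p)"
proof (rule ccontr)
  let ?P = "op_poly A p"
  assume less: "\<not> cmod (poly p z) \<le> norm ?P"
  have "poly (p - [:poly p z:]) z = 0"
    by simp
  \<comment> \<open>The linear factor stands on the right so that \<open>A - z\<close> is applied
    first and inherits the lower bound.\<close>
  then obtain q where q: "p - [:poly p z:] = q * [:- z, 1:]"
    unfolding poly_eq_0_iff_dvd by (metis dvdE mult.commute)
  define Q where "Q = op_poly A q"
  have Q: "?P - scaleC_op (poly p z) = Q o\<^sub>L (A - scaleC_op z)"
    using arg_cong[OF q, of "op_poly A"]
    unfolding op_poly_diff[OF selfadjoint_opsD(1)[OF A]] op_poly_mult[OF selfadjoint_opsD(1)[OF A]]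
      op_poly_linear Q_def
    by simp
  let ?c = "(cmod (poly p z) - norm ?P) / (norm Q + 1)"
  have "?c * norm x \<le> norm (blinfun_apply (A - scaleC_op z) x)" for x
  proof -
    have "(cmod (poly p z) - norm ?P) * norm x \<le> norm (poly p z *\<^sub>C x) - norm (blinfun_apply ?P x)"
      using norm_blinfun[of ?P x] by (simp add: norm_scaleC left_diff_distrib)
    also have "\<dots> \<le> norm (blinfun_apply (?P - scaleC_op (poly p z)) x)"
      using norm_triangle_ineq2[of "poly p z *\<^sub>C x" "blinfun_apply ?P x"]
      by (simp add: blinfun.diff_left norm_minus_commute)
    also have "\<dots> \<le> norm Q * norm (blinfun_apply (A - scaleC_op z) x)"
      unfolding Q using norm_blinfun[of Q "blinfun_apply (A - scaleC_op z) x"] by simp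
    also have "\<dots> \<le> (norm Q + 1) * norm (blinfun_apply (A - scaleC_op z) x)"
      by (intro mult_right_mono) simp_all
    finally show ?thesis
      by (simp add: pos_divide_le_eq add_nonneg_pos mult.commute)
  qed
  moreover have "?c > 0"
    using less by (simp add: add_nonneg_pos)
  ultimately have "bounded_below (A - scaleC_op z)"
    unfolding bounded_below_def by blast
  with z show False
    by (simp add: spectrum_iff_not_bounded_below[OF A])
qed

text \<open>With \<open>s = norm (p(A)) ^ 2\<close> and \<open>N = p(A)* p(A)\<close>, the identity
  \<open>norm (N x - s x) ^ 2 = norm (N x) ^ 2 - 2 s norm (p(A) x) ^ 2 + s ^ 2 norm x ^ 2\<close> shows that
  \<open>N - s\<close> is not bounded below, so that the polynomial defining it vanishes on the spectrum.\<close>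

lemma norm_op_poly_attained_aux:
  fixes A :: "'a::complex_hilbert_space operator"
  assumes A: "A \<in> selfadjoint_ops" and pos: "norm (op_poly A p) > 0"
    and nonconst: "degree p > 0 \<or> spectrum A \<noteq> {}"
  shows "\<exists>z\<in>spectrum A. cmod (poly p z) = norm (op_poly A p)"
proof -
  define P where "P = op_poly A p"
  define P' where "P' = op_poly A (map_poly cnj p)"
  define s where "s = (norm P)\<^sup>2"
  define q where "q = map_poly cnj p * p - [:complex_of_real s:]"
  have A_bounded: "A \<in> bounded_ops"
    using A by (rule selfadjoint_opsD)
  have adj: "is_adjoint P P'"
    unfolding P_def P'_def by (rule is_adjoint_op_poly[OF A])
  have P': "norm P' \<le> norm P"
    by (rule is_adjoint_norm_le[OF adj])
  have s: "s > 0"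
    using pos by (simp add: s_def P_def)
  have Q: "blinfun_apply (op_poly A q) x = blinfun_apply P' (blinfun_apply P x) - s *\<^sub>R x" for x
    by (simp add: q_def op_poly_diff[OF A_bounded] op_poly_mult[OF A_bounded] P_def P'_def
        blinfun.diff_left blinfun.add_left scaleR_scaleC)
  have "\<not> bounded_below (op_poly A q)"
  proof
    assume "bounded_below (op_poly A q)"
    then obtain c where c: "c > 0" "\<And>x. c * norm x \<le> norm (blinfun_apply (op_poly A q) x)"
      by (auto simp: bounded_below_def)
    \<comment> \<open>A lower bound \<open>c\<close> for \<open>N - s\<close> improves the estimate
      of the squared norm of \<open>P x\<close> from factor \<open>s\<close> to this smaller
      \<open>r\<close>, contradicting that \<open>s\<close> is the squared operator norm.\<close>
    define r where "r = s - c\<^sup>2 / s"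
    have bound: "(norm (blinfun_apply P x))\<^sup>2 \<le> r * (norm x)\<^sup>2" for x
    proof -
      let ?y = "blinfun_apply P x"
      have "norm (blinfun_apply P' ?y) \<le> norm P * norm ?y"
        using norm_blinfun[of P' ?y] P' by (meson mult_right_mono norm_ge_zero order_trans)
      then have 1: "(norm (blinfun_apply P' ?y))\<^sup>2 \<le> s * (norm ?y)\<^sup>2"
        unfolding s_def by (metis norm_ge_zero power_mono power_mult_distrib)
      have "(c * norm x)\<^sup>2 \<le> (norm (blinfun_apply (op_poly A q) x))\<^sup>2"
        using c by (intro power_mono) auto
      also have "\<dots> = (norm (blinfun_apply P' ?y))\<^sup>2 - 2 * s * (x \<bullet> blinfun_apply P' ?y)
          + s\<^sup>2 * (norm x)\<^sup>2"
        unfolding Q power2_norm_eq_inner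
        by (simp add: inner_diff_left inner_diff_right inner_commute power2_eq_square)
      also have "x \<bullet> blinfun_apply P' ?y = (norm ?y)\<^sup>2"
        by (simp add: is_adjoint_inner[OF adj, symmetric] power2_norm_eq_inner)
      finally have "c\<^sup>2 * (norm x)\<^sup>2 \<le> s\<^sup>2 * (norm x)\<^sup>2 - s * (norm ?y)\<^sup>2"
        using 1 by (simp add: power_mult_distrib)
      then have "s * (norm ?y)\<^sup>2 \<le> (s\<^sup>2 - c\<^sup>2) * (norm x)\<^sup>2"
        by (simp add: left_diff_distrib)
      then have "(norm ?y)\<^sup>2 \<le> (s\<^sup>2 - c\<^sup>2) * (norm x)\<^sup>2 / s"
        using s by (simp add: pos_le_divide_eq mult.commute)
      also have "\<dots> = r * (norm x)\<^sup>2"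
        using s by (simp add: r_def field_simps power2_eq_square)
      finally show ?thesis .
    qed
    have nonneg: "0 \<le> r"
    proof -
      obtain x where "blinfun_apply P x \<noteq> 0"
        using pos by (metis P_def blinfun_eqI norm_zero order_less_irrefl zero_blinfun.rep_eq)
      then have "0 < (norm (blinfun_apply P x))\<^sup>2" "x \<noteq> 0"
        by auto
      with bound[of x] have "0 < r * (norm x)\<^sup>2"
        by linarith
      then show ?thesis
        by (simp add: zero_less_mult_iff)
    qed
    have "norm P \<le> sqrt r"
    proof (rule norm_blinfun_bound)
      show "norm (blinfun_apply P x) \<le> sqrt r * norm x" for x
        by (rule power2_le_imp_le) (simp_all add: nonneg bound power_mult_distrib)
    qed (simp add: nonneg)
    then have "(norm P)\<^sup>2 \<le> (sqrt r)\<^sup>2"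
      by (intro power_mono) simp_all
    then have "s \<le> r"
      using nonneg by (simp add: s_def)
    then show False
      using c(1) s by (simp add: r_def zero_less_divide_iff flip: not_less)
  qed
  \<comment> \<open>\<open>op_poly_bounded_below\<close> says nothing about \<open>q = 0\<close>.
    For nonconstant \<open>p\<close> the degree of \<open>q\<close> is twice that of
    \<open>p\<close>; for constant \<open>p\<close>, if \<open>q = 0\<close>, any point of the
    nonempty spectrum is a root.\<close>
  moreover have "q \<noteq> 0 \<or> spectrum A \<noteq> {}"
    using nonconst
  proof
    assume deg: "degree p > 0"
    have "degree (map_poly cnj p * p) = degree p + degree p"
      using deg by (subst degree_mult_eq) (auto simp: map_poly_eq_0_iff degree_map_poly)
    with deg show ?thesis
      by (auto simp: q_def)
  qed simp
  ultimately obtain z where z: "z \<in> spectrum A" "poly q z = 0"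
    using op_poly_bounded_below[OF A, of q] by (cases "q = 0") auto
  have "cnj z = z"
    using spectrum_Im_0[OF A z(1)] by (simp add: complex_eq_iff)
  then have "poly (map_poly cnj p) z = cnj (poly p z)"
    using poly_cnj[of p z] by simp
  then have "cnj (poly p z) * poly p z = complex_of_real s"
    using z(2) by (simp add: q_def)
  then have "complex_of_real ((cmod (poly p z))\<^sup>2) = complex_of_real s"
    unfolding complex_norm_square by (simp add: mult.commute)
  then have "(cmod (poly p z))\<^sup>2 = (norm P)\<^sup>2"
    unfolding of_real_eq_iff s_def .
  then show ?thesis
    using z(1) by (auto simp: P_def power2_eq_iff_nonneg)
qed

text \<open>It remains to see that the spectrum is nonempty on a nonzero space. For nonzero
  \<open>A\<close> the auxiliary lemma for the identity polynomial already produces a spectral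
  point; for \<open>A = 0\<close> the point is 0.\<close>

lemma norm_op_poly_attained:
  fixes A :: "'a::complex_hilbert_space operator"
  assumes A: "A \<in> selfadjoint_ops" and pos: "norm (op_poly A p) > 0"
  shows "\<exists>z\<in>spectrum A. cmod (poly p z) = norm (op_poly A p)"
proof (rule norm_op_poly_attained_aux[OF A pos])
  have "spectrum A \<noteq> {}"
  proof (cases "A = 0")
    case True
    obtain x where "blinfun_apply (op_poly A p) x \<noteq> 0"
      using pos by (metis blinfun_eqI norm_zero order_less_irrefl zero_blinfun.rep_eq)
    then have "x \<noteq> 0"
      by auto
    then have "\<not> bounded_below (A - scaleC_op 0)"
      using True by (auto simp: bounded_below_def blinfun.diff_left blinfun.minus_left
          mult_le_0_iff not_le intro!: exI[of _ x])
    then show ?thesis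
      using spectrum_iff_not_bounded_below[OF A] by blast
  next
    case False
    moreover have "op_poly A [:0, 1:] = A"
      using op_poly_linear[of A 0] by (auto intro!: blinfun_eqI simp: blinfun.diff_left)
    ultimately show ?thesis
      using norm_op_poly_attained_aux[OF A, of "[:0, 1:]"] by auto
  qed
  then show "degree p > 0 \<or> spectrum A \<noteq> {}" ..
qed

section \<open>The continuous functional calculus\<close>

text \<open>The assumption \<open>0 \<le> e\<close> carries the case of an empty spectrum, where the
  bound on values is vacuous.\<close>

lemma norm_op_poly_le:
  assumes "A \<in> selfadjoint_ops" and "0 \<le> e" and "\<And>z. z \<in> spectrum A \<Longrightarrow> cmod (poly p z) \<le> e"
  shows "norm (op_poly A p) \<le> e"
proof (cases "norm (op_poly A p) > 0")
  case True
  then show ?thesis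
    using norm_op_poly_attained[OF assms(1) True] assms(3) by force
qed (use assms(2) in simp)

text \<open>On a real set \<open>g\<close> is a function of \<open>Re z\<close>. The
  Stone-Weierstrass theorem approximates it on the real line, and the real polynomials for its real
  and imaginary parts combine into one complex polynomial.\<close>

lemma complex_polynomials_dense:
  assumes "compact K" and real: "\<And>z. z \<in> K \<Longrightarrow> Im z = 0" and g: "continuous_on K g"
  obtains p :: "nat \<Rightarrow> complex poly" where "uniform_limit K (\<lambda>n. poly (p n)) g sequentially"
proof -
  have K: "complex_of_real (Re z) = z" if "z \<in> K" for z
    using real[OF that] by (simp add: complex_eq_iff)
  have approx: "\<exists>p. \<forall>z\<in>K. cmod (g z - poly p z) < e" if e: "e > 0" for e
  proof -
    have cont: "continuous_on (Re ` K) (\<lambda>x. g (complex_of_real x))"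
      by (intro continuous_on_compose2[OF g] continuous_intros) (auto simp: K)
    have "compact (Re ` K)"
      by (intro compact_continuous_image continuous_intros assms)
    then obtain h where h: "polynomial_function h"
        "\<And>x. x \<in> Re ` K \<Longrightarrow> norm (g (complex_of_real x) - h x) < e"
      using Stone_Weierstrass_polynomial_function[OF _ cont e]
      by blast
    have "real_polynomial_function (\<lambda>x. Re (h x))" "real_polynomial_function (\<lambda>x. Im (h x))"
      using h(1) bounded_linear_Re bounded_linear_Im
      by (auto simp: polynomial_function_def o_def)
    then obtain a m b n where ab: "(\<lambda>x. Re (h x)) = (\<lambda>x. \<Sum>i\<le>m. a i * x ^ i)"
        "(\<lambda>x. Im (h x)) = (\<lambda>x. \<Sum>i\<le>n. b i * x ^ i)"
      unfolding real_polynomial_function_iff_sum by blast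
    define p where "p = (\<Sum>i\<le>m. monom (complex_of_real (a i)) i)
      + smult \<i> (\<Sum>i\<le>n. monom (complex_of_real (b i)) i)"
    have "poly p (complex_of_real x)
        = complex_of_real (\<Sum>i\<le>m. a i * x ^ i) + \<i> * complex_of_real (\<Sum>i\<le>n. b i * x ^ i)" for x
      by (simp add: p_def poly_sum poly_monom)
    then have "poly p (complex_of_real x) = h x" for x
      using fun_cong[OF ab(1), of x] fun_cong[OF ab(2), of x] by (simp add: complex_eq_iff)
    then show ?thesis
      using h(2) K by (metis image_eqI)
  qed
  have "\<forall>n. \<exists>p. \<forall>z\<in>K. cmod (g z - poly p z) < 1 / real (Suc n)"
    by (intro allI approx) simp
  then obtain p where p: "\<And>n z. z \<in> K \<Longrightarrow> cmod (g z - poly (p n) z) < 1 / real (Suc n)"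
    by metis
  have "uniform_limit K (\<lambda>n. poly (p n)) g sequentially"
  proof (rule uniform_limitI)
    fix e :: real assume "e > 0"
    have "\<forall>\<^sub>F n in sequentially. 1 / real (Suc n) < e"
      using LIMSEQ_inverse_real_of_nat \<open>e > 0\<close>
      by (auto simp: inverse_eq_divide dest: order_tendstoD(2))
    then show "\<forall>\<^sub>F n in sequentially. \<forall>z\<in>K. dist (poly (p n) z) (g z) < e"
    proof eventually_elim
      case (elim n)
      then show ?case
        using p[of _ n] by (force simp: dist_norm norm_minus_commute)
    qed
  qed
  then show thesis ..
qed

text \<open>The graph of the functional calculus. As a relation it lets the algebraic rules be
  proved on approximating sequences before independence of the sequence is known.\<close>

definition op_limit ::
    "'a::complex_hilbert_space operator \<Rightarrow> (complex \<Rightarrow> complex) \<Rightarrow> 'a operator \<Rightarrow> bool" where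
  "op_limit A g T \<longleftrightarrow> (\<exists>p. uniform_limit (spectrum A) (\<lambda>n. poly (p n)) g sequentially \<and>
     (\<lambda>n. op_poly A (p n)) \<longlonglongrightarrow> T)"

lemma op_poly_convergent:
  assumes A: "A \<in> selfadjoint_ops"
    and lim: "uniform_limit (spectrum A) (\<lambda>n. poly (p n)) g sequentially"
  obtains T where "(\<lambda>n. op_poly A (p n)) \<longlonglongrightarrow> T"
proof -
  have "Cauchy (\<lambda>n. op_poly A (p n))"
  proof (rule metric_CauchyI)
    fix e :: real assume "e > 0"
    \<comment> \<open>\<open>norm_op_poly_le\<close> gives a non-strict bound, here
      \<open>e / 2\<close>, which leaves room for the strict Cauchy estimate.\<close>
    then have "e / 4 > 0"
      by simp
    then obtain N where N: "\<And>n z. n \<ge> N \<Longrightarrow> z \<in> spectrum A \<Longrightarrow> dist (poly (p n) z) (g z) < e / 4"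
      using lim unfolding uniform_limit_sequentially_iff by blast
    have "norm (op_poly A (p m - p n)) \<le> e / 2" if "m \<ge> N" "n \<ge> N" for m n
    proof (rule norm_op_poly_le[OF A])
      fix z assume z: "z \<in> spectrum A"
      show "cmod (poly (p m - p n) z) \<le> e / 2"
        using N[OF that(1) z] N[OF that(2) z] dist_triangle2[of "poly (p m) z" "poly (p n) z" "g z"]
        by (simp add: dist_norm)
    qed (use \<open>e > 0\<close> in simp)
    then show "\<exists>M. \<forall>m\<ge>M. \<forall>n\<ge>M. dist (op_poly A (p m)) (op_poly A (p n)) < e"
      using \<open>e > 0\<close>
      by (intro exI[of _ N]) (force simp: dist_norm op_poly_diff[OF selfadjoint_opsD(1)[OF A]])
  qed
  then show thesis
    using that Cauchy_convergent convergent_def by blast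
qed

lemma op_limit_exists:
  assumes "A \<in> selfadjoint_ops" and "continuous_on (spectrum A) g"
  shows "\<exists>T. op_limit A g T"
  using complex_polynomials_dense[OF compact_spectrum[OF assms(1)] spectrum_Im_0[OF assms(1)]
      assms(2)] op_poly_convergent[OF assms(1)]
  unfolding op_limit_def by metis

lemma op_limit_poly: "op_limit A (poly p) (op_poly A p)"
  unfolding op_limit_def by (intro exI[of _ "\<lambda>_. p"]) (simp add: uniform_limit_const)

section \<open>Algebraic rules for limits of polynomials in an operator\<close>

lemma op_limit_add:
  assumes "op_limit A g T" and "op_limit A h U"
  shows "op_limit A (\<lambda>z. g z + h z) (T + U)"
proof -
  obtain p q where "uniform_limit (spectrum A) (\<lambda>n. poly (p n)) g sequentially"
    "uniform_limit (spectrum A) (\<lambda>n. poly (q n)) h sequentially"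
    "(\<lambda>n. op_poly A (p n)) \<longlonglongrightarrow> T" "(\<lambda>n. op_poly A (q n)) \<longlonglongrightarrow> U"
    using assms by (auto simp: op_limit_def)
  then show ?thesis
    unfolding op_limit_def
    by (intro exI[of _ "\<lambda>n. p n + q n"])
      (auto simp: op_poly_add poly_add[abs_def] intro!: tendsto_add uniform_limit_add)
qed

lemma op_limit_mult:
  assumes A: "A \<in> selfadjoint_ops" and "op_limit A g T" and "op_limit A h U"
    and "continuous_on (spectrum A) g" and "continuous_on (spectrum A) h"
  shows "op_limit A (\<lambda>z. g z * h z) (T o\<^sub>L U)"
proof -
  obtain p q where lim: "uniform_limit (spectrum A) (\<lambda>n. poly (p n)) g sequentially"
    "uniform_limit (spectrum A) (\<lambda>n. poly (q n)) h sequentially"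
    "(\<lambda>n. op_poly A (p n)) \<longlonglongrightarrow> T" "(\<lambda>n. op_poly A (q n)) \<longlonglongrightarrow> U"
    using assms by (auto simp: op_limit_def)
  \<comment> \<open>Uniform limits multiply only if the limit functions are bounded; compactness of
    the spectrum supplies this.\<close>
  have "bounded (g ` spectrum A)" "bounded (h ` spectrum A)"
    using assms(4,5) compact_spectrum[OF A]
    by (auto intro: compact_imp_bounded compact_continuous_image)
  with lim show ?thesis
    unfolding op_limit_def
    by (intro exI[of _ "\<lambda>n. p n * q n"])
      (auto simp: op_poly_mult[OF selfadjoint_opsD(1)[OF A]] poly_mult[abs_def]
        intro!: uniform_lim_mult bounded_bilinear.tendsto[OF bounded_bilinear_blinfun_compose])
qed

lemma op_limit_bounded_ops:
  assumes "A \<in> bounded_ops" and "op_limit A g T"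
  shows "T \<in> bounded_ops"
proof -
  obtain p where "(\<lambda>n. op_poly A (p n)) \<longlonglongrightarrow> T"
    using assms(2) by (auto simp: op_limit_def)
  then show ?thesis
    by (rule bounded_ops_LIMSEQ[OF op_poly_bounded_ops[OF assms(1)]])
qed

lemma op_limit_cmod_le:
  assumes A: "A \<in> selfadjoint_ops" and "op_limit A g T" and z: "z \<in> spectrum A"
  shows "cmod (g z) \<le> norm T"
proof -
  obtain p where p: "uniform_limit (spectrum A) (\<lambda>n. poly (p n)) g sequentially"
    "(\<lambda>n. op_poly A (p n)) \<longlonglongrightarrow> T"
    using assms by (auto simp: op_limit_def)
  show ?thesis
  proof (rule LIMSEQ_le)
    show "(\<lambda>n. cmod (poly (p n) z)) \<longlonglongrightarrow> cmod (g z)"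
      by (intro tendsto_norm tendsto_uniform_limitI[OF p(1) z])
    show "(\<lambda>n. norm (op_poly A (p n))) \<longlonglongrightarrow> norm T"
      by (intro tendsto_norm p)
  qed (use cmod_poly_spectrum_le[OF A z] in auto)
qed

text \<open>With \<open>op_limit_cmod_le\<close> this is isometry. The slack \<open>d\<close>
  absorbs the error of the approximating polynomials.\<close>

lemma op_limit_norm_le:
  assumes A: "A \<in> selfadjoint_ops" and "op_limit A g T" and "0 \<le> e"
    and g: "\<And>z. z \<in> spectrum A \<Longrightarrow> cmod (g z) \<le> e"
  shows "norm T \<le> e"
proof (rule field_le_epsilon)
  fix d :: real assume d: "d > 0"
  obtain p where p: "uniform_limit (spectrum A) (\<lambda>n. poly (p n)) g sequentially"
    "(\<lambda>n. op_poly A (p n)) \<longlonglongrightarrow> T"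
    using assms by (auto simp: op_limit_def)
  have "\<forall>\<^sub>F n in sequentially. norm (op_poly A (p n)) \<le> e + d"
    using uniform_limitD[OF p(1) d]
  proof eventually_elim
    case (elim n)
    show ?case
    proof (rule norm_op_poly_le[OF A])
      fix z assume z: "z \<in> spectrum A"
      have "cmod (poly (p n) z) \<le> cmod (g z) + cmod (poly (p n) z - g z)"
        by (metis add.commute diff_add_cancel norm_triangle_ineq)
      then show "cmod (poly (p n) z) \<le> e + d"
        using elim z g[OF z] by (force simp: dist_norm)
    qed (use d assms(3) in simp)
  qed
  then show "norm T \<le> e + d"
    by (intro tendsto_upperbound[OF tendsto_norm[OF p(2)]]) simp_all
qed

lemma op_limit_scaleC_op:
  assumes A: "A \<in> selfadjoint_ops" and "op_limit A g T"
    and "continuous_on (spectrum A) g"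
  shows "op_limit A (\<lambda>z. c * g z) (scaleC_op c o\<^sub>L T)"
proof -
  have "poly [:c:] = (\<lambda>z. c)" "op_poly A [:c:] = scaleC_op c"
    by (auto intro!: blinfun_eqI simp: blinfun.add_left)
  then have "op_limit A (\<lambda>z. c) (scaleC_op c)"
    using op_limit_poly[of A "[:c:]"] by simp
  then show ?thesis
    using op_limit_mult[OF A] assms by simp
qed

text \<open>\<open>T\<close> and \<open>U\<close> may come from different sequences; their
  difference is a limit for the zero function, so its norm is at most 0.\<close>

lemma op_limit_unique:
  assumes A: "A \<in> selfadjoint_ops" and "op_limit A g T" and U: "op_limit A g U"
    and g: "continuous_on (spectrum A) g"
  shows "T = U"
proof -
  have "scaleC_op (- 1) o\<^sub>L U = - U"
    by (rule blinfun_eqI) (simp add: blinfun.minus_left)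
  then have "op_limit A (\<lambda>z. g z + (- 1) * g z) (T + - U)"
    using op_limit_add[OF assms(2) op_limit_scaleC_op[OF A U g, of "- 1"]] by simp
  then have "norm (T + - U) \<le> 0"
    by (rule op_limit_norm_le[OF A]) simp_all
  then show ?thesis by simp
qed

text \<open>Conjugating the coefficients of the approximating polynomials works because the spectrum
  is real: there the conjugated polynomial takes the conjugate value.\<close>

lemma op_limit_adjoint:
  assumes A: "A \<in> selfadjoint_ops" and "op_limit A g T"
  obtains U where "op_limit A (\<lambda>z. cnj (g z)) U" and "is_adjoint T U"
proof -
  obtain p where p: "uniform_limit (spectrum A) (\<lambda>n. poly (p n)) g sequentially"
    "(\<lambda>n. op_poly A (p n)) \<longlonglongrightarrow> T"
    using assms by (auto simp: op_limit_def)
  have cnj: "poly (map_poly cnj q) z = cnj (poly q z)" if "z \<in> spectrum A" for q z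
  proof -
    have "cnj z = z"
      using spectrum_Im_0[OF A that] by (simp add: complex_eq_iff)
    then show ?thesis
      using poly_cnj[of q z] by simp
  qed
  have "dist (cnj v) (cnj w) = dist v w" for v w
    by (metis complex_cnj_diff complex_mod_cnj dist_norm)
  then have "dist (poly (map_poly cnj q) z) (cnj (g z)) = dist (poly q z) (g z)"
    if "z \<in> spectrum A" for q z
    using cnj[OF that] by (simp only:)
  then have lim: "uniform_limit (spectrum A) (\<lambda>n. poly (map_poly cnj (p n)))
      (\<lambda>z. cnj (g z)) sequentially"
    using p(1) by (simp add: uniform_limit_sequentially_iff)
  obtain U where U: "(\<lambda>n. op_poly A (map_poly cnj (p n))) \<longlonglongrightarrow> U"
    by (rule op_poly_convergent[OF A lim])
  show thesis
  proof
    show "op_limit A (\<lambda>z. cnj (g z)) U"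
      using lim U by (auto simp: op_limit_def)
    show "is_adjoint T U"
      by (rule is_adjoint_LIMSEQ[OF _ _ p(2) U])
        (simp_all add: op_poly_bounded_ops selfadjoint_opsD[OF A] is_adjoint_op_poly[OF A])
  qed
qed

theorem functional_calculus_exists:
  assumes A: "A \<in> selfadjoint_ops"
  shows "\<exists>\<Phi>. is_functional_calculus A \<Phi>"
proof -
  \<comment> \<open>For \<open>g\<close> continuous on the spectrum the description is proper, by
    \<open>op_limit_exists\<close> and \<open>op_limit_unique\<close>; only such \<open>g\<close>
    occur in the axioms.\<close>
  define \<Phi> where "\<Phi> g = (THE T. op_limit A g T)" for g
  have eq: "\<Phi> g = T" if "op_limit A g T" "continuous_on (spectrum A) g" for g T
    unfolding \<Phi>_def using that op_limit_unique[OF A] by blast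
  have lim: "op_limit A g (\<Phi> g)" if "continuous_on (spectrum A) g" for g
    using op_limit_exists[OF A that] eq[OF _ that] by blast
  have poly: "\<Phi> (poly p) = op_poly A p" for p
    by (intro eq op_limit_poly continuous_intros)
  have norm: "norm (\<Phi> g) = Sup (insert 0 ((\<lambda>z. cmod (g z)) ` spectrum A))"
    if g: "continuous_on (spectrum A) g" for g
  proof (rule cSup_eq_non_empty[symmetric])
    show "x \<le> norm (\<Phi> g)" if "x \<in> insert 0 ((\<lambda>z. cmod (g z)) ` spectrum A)" for x
      using that op_limit_cmod_le[OF A lim[OF g]] by auto
    show "norm (\<Phi> g) \<le> y"
      if "\<And>x. x \<in> insert 0 ((\<lambda>z. cmod (g z)) ` spectrum A) \<Longrightarrow> x \<le> y" for y
      by (rule op_limit_norm_le[OF A lim[OF g]]) (auto intro: that)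
  qed simp
  have adj: "is_adjoint (\<Phi> g) (\<Phi> (\<lambda>z. cnj (g z)))" if g: "continuous_on (spectrum A) g" for g
  proof -
    obtain U where "op_limit A (\<lambda>z. cnj (g z)) U" "is_adjoint (\<Phi> g) U"
      using op_limit_adjoint[OF A lim[OF g]] by blast
    then show ?thesis
      using eq[of "\<lambda>z. cnj (g z)" U] g by (simp add: continuous_on_cnj)
  qed
  have "is_functional_calculus A \<Phi>"
    unfolding is_functional_calculus_def
  proof (intro conjI allI impI; (elim conjE)?)
    fix g :: "complex \<Rightarrow> complex"
    assume g: "continuous_on (spectrum A) g"
    show "\<Phi> g \<in> bounded_ops"
      using op_limit_bounded_ops lim[OF g] selfadjoint_opsD[OF A] by blast
    show "is_adjoint (\<Phi> g) (\<Phi> (\<lambda>z. cnj (g z)))"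
      by (rule adj[OF g])
    show "norm (\<Phi> g) = Sup (insert 0 ((\<lambda>z. cmod (g z)) ` spectrum A))"
      by (rule norm[OF g])
    fix c x
    have "\<Phi> (\<lambda>z. c * g z) = scaleC_op c o\<^sub>L \<Phi> g"
      by (intro eq op_limit_scaleC_op A lim continuous_intros g)
    then show "blinfun_apply (\<Phi> (\<lambda>z. c * g z)) x = c *\<^sub>C blinfun_apply (\<Phi> g) x"
      by simp
  next
    fix g h :: "complex \<Rightarrow> complex"
    assume g: "continuous_on (spectrum A) g" and h: "continuous_on (spectrum A) h"
    show "\<Phi> (\<lambda>z. g z + h z) = \<Phi> g + \<Phi> h"
      by (intro eq op_limit_add lim continuous_intros g h)
    show "\<Phi> (\<lambda>z. g z * h z) = \<Phi> g o\<^sub>L \<Phi> h"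
      by (intro eq op_limit_mult A lim continuous_intros g h)
  next
    have "poly (1 :: complex poly) = (\<lambda>z. 1)"
      by auto
    then show "\<Phi> (\<lambda>z. 1) = id_blinfun"
      using poly[of 1] by (simp only: op_poly_1)
    have "poly [:0, 1 :: complex:] = (\<lambda>z. z)" "op_poly A [:0, 1:] = A"
      by (auto intro!: blinfun_eqI simp: blinfun.add_left)
    then show "\<Phi> (\<lambda>z. z) = A"
      using poly[of "[:0, 1:]"] by metis
  qed
  then show ?thesis
    by (intro exI[of _ \<Phi>])
qed

text \<open>Needed for an arbitrary calculus, since the one chosen in \<open>fun_op\<close> is known
  only through the axioms.\<close>

lemma functional_calculus_poly:
  assumes \<Phi>: "is_functional_calculus A \<Phi>"
  shows "\<Phi> (poly p) = op_poly A p"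
proof (induction p)
  case 0
  \<comment> \<open>Homogeneity is the axiom that yields the value at the zero function, hence the
    form \<open>0 * 1\<close>.\<close>
  have "blinfun_apply (\<Phi> (\<lambda>z. 0 * 1)) x = 0 *\<^sub>C blinfun_apply (\<Phi> (\<lambda>z. 1)) x" for x
    using \<Phi> continuous_on_const[of "spectrum A" 1] unfolding is_functional_calculus_def by blast
  then show ?case
    by (intro blinfun_eqI) (simp add: poly_0[abs_def])
next
  case (pCons c p)
  have "poly (pCons c p) = (\<lambda>z. c * 1 + z * poly p z)"
    by auto
  moreover have "\<Phi> (\<lambda>z. c * 1 + z * poly p z) = \<Phi> (\<lambda>z. c * 1) + \<Phi> (\<lambda>z. z * poly p z)"
    using \<Phi> unfolding is_functional_calculus_def by (simp add: continuous_intros)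
  moreover have "\<Phi> (\<lambda>z. z * poly p z) = A o\<^sub>L op_poly A p"
    using \<Phi> unfolding is_functional_calculus_def pCons.IH[symmetric]
    by (simp add: continuous_intros)
  moreover have "blinfun_apply (\<Phi> (\<lambda>z. c * 1)) x = c *\<^sub>C blinfun_apply (\<Phi> (\<lambda>z. 1)) x" for x
    using \<Phi> continuous_on_const[of "spectrum A" 1] unfolding is_functional_calculus_def by blast
  then have "\<Phi> (\<lambda>z. c * 1) = scaleC_op c"
    using \<Phi> by (intro blinfun_eqI) (simp add: is_functional_calculus_def)
  ultimately show ?case
    by simp
qed

text \<open>Isometry turns uniform approximation on the spectrum into approximation in operator
  norm.\<close>

lemma functional_calculus_norm_diff_le:
  assumes \<Phi>: "is_functional_calculus A \<Phi>" and g: "continuous_on (spectrum A) g" and "0 \<le> e"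
    and p: "\<And>z. z \<in> spectrum A \<Longrightarrow> cmod (g z - poly p z) \<le> e"
  shows "norm (\<Phi> g - op_poly A p) \<le> e"
proof -
  \<comment> \<open>The axioms speak of sums, so the difference is written as a sum with the
    polynomial \<open>- p\<close>.\<close>
  have diff: "(\<lambda>z. g z - poly p z) = (\<lambda>z. g z + poly (- p) z)"
    by auto
  have "op_poly A (- p) + op_poly A p = 0"
    unfolding op_poly_add[symmetric] by simp
  then have neg: "op_poly A (- p) = - op_poly A p"
    by (simp add: eq_neg_iff_add_eq_0)
  have cont: "continuous_on (spectrum A) (\<lambda>z. g z - poly p z)"
    by (intro continuous_intros g)
  have "\<Phi> (\<lambda>z. g z - poly p z) = \<Phi> g + \<Phi> (poly (- p))"
    unfolding diff using \<Phi> g unfolding is_functional_calculus_def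
    by (simp add: continuous_intros del: poly_minus)
  then have "norm (\<Phi> g - op_poly A p) = norm (\<Phi> (\<lambda>z. g z - poly p z))"
    by (simp add: functional_calculus_poly[OF \<Phi>] neg)
  also have "\<dots> = Sup (insert 0 ((\<lambda>z. cmod (g z - poly p z)) ` spectrum A))"
    using \<Phi> cont unfolding is_functional_calculus_def by blast
  also have "\<dots> \<le> e"
    using assms by (intro cSup_least) auto
  finally show ?thesis .
qed

lemma fun_op_norm_diff_le:
  assumes A: "A \<in> selfadjoint_ops"
    and f: "continuous_on (spectrum A) (\<lambda>z. complex_of_real (f (Re z)))" and "0 \<le> e"
    and "\<And>z. z \<in> spectrum A \<Longrightarrow> cmod (complex_of_real (f (Re z)) - poly p z) \<le> e"
  shows "norm (fun_op f A - op_poly A p) \<le> e"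
  unfolding fun_op_def
  by (rule functional_calculus_norm_diff_le[OF someI_ex[OF functional_calculus_exists[OF A]]])
    (use assms in auto)

section \<open>Spectra along a segment\<close>

lemma op_poly_affine:
  assumes "A \<in> bounded_ops"
  shows "blinfun_apply (op_poly A [:complex_of_real a, complex_of_real b:]) x
    = a *\<^sub>R x + b *\<^sub>R blinfun_apply A x"
  by (simp add: blinfun.add_left scaleR_scaleC bounded_opsD[OF assms])

text \<open>The affine function is the square of \<open>h z = sqrt (a + b * Re z)\<close> on the spectrum, so
  \<open>a + b A = \<Phi> h \<Phi> h\<close> with \<open>\<Phi> h\<close> selfadjoint.\<close>

lemma affine_nonneg_on_spectrum:
  assumes A: "A \<in> selfadjoint_ops" and nonneg: "\<And>z. z \<in> spectrum A \<Longrightarrow> 0 \<le> a + b * Re z"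
  shows "0 \<le> a * (norm x)\<^sup>2 + b * (blinfun_apply A x \<bullet> x)"
proof -
  obtain \<Phi> where \<Phi>: "is_functional_calculus A \<Phi>"
    using functional_calculus_exists[OF A] by blast
  define h where "h z = complex_of_real (sqrt (a + b * Re z))" for z
  let ?p = "[:complex_of_real a, complex_of_real b:]"
  have h: "continuous_on (spectrum A) h"
    unfolding h_def by (intro continuous_intros)
  have "norm (\<Phi> (\<lambda>z. h z * h z) - op_poly A ?p) \<le> 0"
  proof (rule functional_calculus_norm_diff_le[OF \<Phi>])
    fix z assume z: "z \<in> spectrum A"
    have "poly ?p z = complex_of_real (a + b * Re z)"
      using spectrum_Im_0[OF A z] by (simp add: complex_eq_iff)
    moreover have "h z * h z = complex_of_real (a + b * Re z)"
      unfolding h_def of_real_mult[symmetric] using nonneg[OF z] by simp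
    ultimately show "cmod (h z * h z - poly ?p z) \<le> 0"
      by (simp del: poly_pCons)
  qed (auto intro!: continuous_intros h)
  then have eq: "op_poly A ?p = \<Phi> h o\<^sub>L \<Phi> h"
    using \<Phi> h unfolding is_functional_calculus_def by auto
  have "(\<lambda>z. cnj (h z)) = h"
    by (simp add: h_def fun_eq_iff)
  then have adj: "is_adjoint (\<Phi> h) (\<Phi> h)"
    using \<Phi> h unfolding is_functional_calculus_def by metis
  have "a * (norm x)\<^sup>2 + b * (blinfun_apply A x \<bullet> x) = blinfun_apply (op_poly A ?p) x \<bullet> x"
    unfolding op_poly_affine[OF selfadjoint_opsD(1)[OF A]]
    by (simp add: inner_add_left power2_norm_eq_inner)
  also have "\<dots> = (norm (blinfun_apply (\<Phi> h) x))\<^sup>2"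
    unfolding eq by (simp add: is_adjoint_inner[OF adj] power2_norm_eq_inner)
  finally show ?thesis by simp
qed

text \<open>Compactness turns pointwise positivity into a uniform gap \<open>c\<close>, and
  \<open>affine_nonneg_on_spectrum\<close> carries it over to the quadratic form. The factor
  \<open>b\<close> is later 1 or -1 and selects the side of \<open>r\<close>.\<close>

lemma spectrum_gap:
  assumes A: "A \<in> selfadjoint_ops" and pos: "\<And>z. z \<in> spectrum A \<Longrightarrow> 0 < b * (r - Re z)"
  obtains c where "c > 0"
    and "\<And>x. c * (norm x)\<^sup>2 \<le> b * (r * (norm x)\<^sup>2 - blinfun_apply A x \<bullet> x)"
proof -
  obtain c where c: "c > 0" "\<And>z. z \<in> spectrum A \<Longrightarrow> c \<le> b * (r - Re z)"
  proof (cases "spectrum A = {}")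
    case False
    have "continuous_on (spectrum A) (\<lambda>z. b * (r - Re z))"
      by (intro continuous_intros)
    then obtain w where "w \<in> spectrum A" "\<forall>z\<in>spectrum A. b * (r - Re w) \<le> b * (r - Re z)"
      using continuous_attains_inf[OF compact_spectrum[OF A] False] by blast
    then show thesis
      using that[of "b * (r - Re w)"] pos by blast
  qed (use that[of 1] in simp)
  show thesis
  proof
    fix x
    have "0 \<le> (b * r - c) * (norm x)\<^sup>2 + (- b) * (blinfun_apply A x \<bullet> x)"
      by (rule affine_nonneg_on_spectrum[OF A]) (use c(2) in \<open>force simp: algebra_simps\<close>)
    then show "c * (norm x)\<^sup>2 \<le> b * (r * (norm x)\<^sup>2 - blinfun_apply A x \<bullet> x)"
      by (simp add: algebra_simps)
  qed (rule c)
qed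

lemma spectrum_inD:
  assumes "spectrum_in A I" and "z \<in> spectrum A"
  shows "Re z \<in> I"
  using assms by (auto simp: spectrum_in_def)

lemma spectrum_in_segment:
  assumes A: "A \<in> selfadjoint_ops" and D: "D \<in> selfadjoint_ops" and I: "is_interval I"
    and specA: "spectrum_in A I" and specV: "spectrum_in (A + D) I" and t: "t \<in> {0..1}"
  shows "spectrum_in (A + t *\<^sub>R D) I"
  unfolding spectrum_in_def
proof
  let ?C = "A + t *\<^sub>R D"
  have C: "?C \<in> selfadjoint_ops" and V: "A + D \<in> selfadjoint_ops"
    using selfadjoint_ops_add_scaleR[OF A D, of t] selfadjoint_ops_add_scaleR[OF A D, of 1]
    by simp_all
  fix z assume z: "z \<in> spectrum ?C"
  define r where "r = Re z"
  have zr: "z = complex_of_real r"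
    using spectrum_Im_0[OF C z] by (simp add: r_def complex_eq_iff)
  have "r \<in> I"
  proof (rule ccontr)
    assume r: "r \<notin> I"
    \<comment> \<open>An interval that misses \<open>r\<close> lies on one side of it:
      \<open>b = 1\<close> if below, \<open>b = - 1\<close> if above.\<close>
    obtain b :: real where b: "\<bar>b\<bar> = 1" "\<And>y. y \<in> I \<Longrightarrow> 0 < b * (r - y)"
    proof (cases "\<exists>y\<in>I. y < r")
      case True
      then obtain y where "y \<in> I" "y < r" by blast
      then have "w < r" if "w \<in> I" for w
        using I r that unfolding is_interval_1 by (meson less_imp_le not_le)
      then show thesis
        using that[of 1] by auto
    next
      case False
      with r have "r < w" if "w \<in> I" for w
        using that by (metis not_less_iff_gr_or_eq)
      then show thesis
        using that[of "- 1"] by auto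
    qed
    obtain c where c: "c > 0"
        "\<And>x. c * (norm x)\<^sup>2 \<le> b * (r * (norm x)\<^sup>2 - blinfun_apply A x \<bullet> x)"
      using spectrum_gap[OF A] b(2) spectrum_inD[OF specA] by metis
    obtain d where d: "d > 0"
        "\<And>x. d * (norm x)\<^sup>2 \<le> b * (r * (norm x)\<^sup>2 - blinfun_apply (A + D) x \<bullet> x)"
      using spectrum_gap[OF V] b(2) spectrum_inD[OF specV] by metis
    define m where "m = min c d"
    have m: "m > 0"
      using c(1) d(1) by (simp add: m_def)
    have "m * norm x \<le> norm (blinfun_apply (?C - scaleC_op z) x)" for x
    proof (cases "x = 0")
      case False
      have "m * (norm x)\<^sup>2 \<le> c * (norm x)\<^sup>2" "m * (norm x)\<^sup>2 \<le> d * (norm x)\<^sup>2"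
        by (auto simp: m_def intro!: mult_right_mono)
      then have "m * (norm x)\<^sup>2 \<le> b * (r * (norm x)\<^sup>2 - blinfun_apply A x \<bullet> x)"
        "m * (norm x)\<^sup>2 \<le> b * (r * (norm x)\<^sup>2 - blinfun_apply (A + D) x \<bullet> x)"
        using c(2)[of x] d(2)[of x] by linarith+
      then have "(1 - t) * (m * (norm x)\<^sup>2) + t * (m * (norm x)\<^sup>2)
          \<le> (1 - t) * (b * (r * (norm x)\<^sup>2 - blinfun_apply A x \<bullet> x))
            + t * (b * (r * (norm x)\<^sup>2 - blinfun_apply (A + D) x \<bullet> x))"
        using t by (intro add_mono mult_left_mono) auto
      also have "\<dots> = b * (- (blinfun_apply (?C - scaleC_op z) x \<bullet> x))"
        by (simp add: zr blinfun.diff_left blinfun.add_left blinfun.scaleR_left inner_diff_left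
            inner_add_left scaleR_scaleC[symmetric] power2_norm_eq_inner algebra_simps)
      also have "\<dots> \<le> \<bar>b\<bar> * \<bar>blinfun_apply (?C - scaleC_op z) x \<bullet> x\<bar>"
        by (metis abs_ge_self abs_minus_cancel abs_mult)
      also have "\<dots> \<le> norm (blinfun_apply (?C - scaleC_op z) x) * norm x"
        using b(1) Cauchy_Schwarz_ineq2 by simp
      finally have "m * norm x * norm x \<le> norm (blinfun_apply (?C - scaleC_op z) x) * norm x"
        by (simp add: algebra_simps power2_eq_square)
      then show ?thesis
        using False by simp
    qed simp
    with m have "bounded_below (?C - scaleC_op z)"
      unfolding bounded_below_def by blast
    with z show False
      by (simp add: spectrum_iff_not_bounded_below[OF C])
  qed
  then show "z \<in> complex_of_real ` I"
    by (simp add: zr)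
qed

text \<open>\<open>f\<close> is continuous on \<open>I\<close>, which may be open or unbounded;
  uniform polynomial approximation requires a compact part of it.\<close>

lemma spectrum_in_compact_subinterval:
  assumes A: "A \<in> selfadjoint_ops" and V: "V \<in> selfadjoint_ops" and I: "is_interval I"
    and specA: "spectrum_in A I" and specV: "spectrum_in V I"
  obtains a b where "{a..b} \<subseteq> I" and "spectrum_in A {a..b}" and "spectrum_in V {a..b}"
proof -
  let ?R = "Re ` (spectrum A \<union> spectrum V)"
  have R: "compact ?R"
    by (intro compact_continuous_image continuous_intros compact_Un compact_spectrum A V)
  have RI: "?R \<subseteq> I"
    using spectrum_inD[OF specA] spectrum_inD[OF specV] by auto
  have spec: "spectrum_in A {a..b} \<and> spectrum_in V {a..b}" if "?R \<subseteq> {a..b}" for a b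
  proof -
    have "z = complex_of_real (Re z)" if "z \<in> spectrum A \<union> spectrum V" for z
      using that spectrum_Im_0[OF A] spectrum_Im_0[OF V] by (auto simp: complex_eq_iff)
    then show ?thesis
      using that by (fastforce simp: spectrum_in_def)
  qed
  show thesis
  proof (cases "?R = {}")
    case True
    \<comment> \<open>\<open>{1..0}\<close> is empty, as both spectra are; this is the case of the
      zero space.\<close>
    then show thesis
      using that[of 1 0] spec[of 1 0] by simp
  next
    case False
    obtain a where a: "a \<in> ?R" "\<forall>y\<in>?R. a \<le> y"
      using compact_attains_inf[OF R False] by blast
    obtain b where b: "b \<in> ?R" "\<forall>y\<in>?R. y \<le> b"
      using compact_attains_sup[OF R False] by blast
    have "a \<in> I" "b \<in> I"
      using a(1) b(1) RI by blast+
    then have "{a..b} \<subseteq> I"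
      using mem_is_interval_1_I[OF I, of a b] by auto
    moreover have "?R \<subseteq> {a..b}"
      using a(2) b(2) by auto
    ultimately show thesis
      using that spec by blast
  qed
qed

section \<open>Norm continuity along a segment\<close>

lemma continuous_on_op_poly:
  "continuous_on X T \<Longrightarrow> continuous_on X (\<lambda>t. op_poly (T t) p)"
proof (induction p)
  case (pCons c p)
  then show ?case
    by (simp, intro continuous_intros
        bounded_bilinear.continuous_on[OF bounded_bilinear_blinfun_compose]) auto
qed simp

lemma continuous_on_fun_op_segment:
  assumes A: "A \<in> selfadjoint_ops" and D: "D \<in> selfadjoint_ops" and I: "is_interval I"
    and specA: "spectrum_in A I" and specV: "spectrum_in (A + D) I" and f: "continuous_on I f"
  shows "continuous_on {0..1} (\<lambda>t. fun_op f (A + t *\<^sub>R D))"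
proof -
  have V: "A + D \<in> selfadjoint_ops"
    using selfadjoint_ops_add_scaleR[OF A D, of 1] by simp
  \<comment> \<open>One interval serves all \<open>t\<close>: \<open>spectrum_in_segment\<close>
    applied to \<open>{a..b}\<close> confines every spectrum on the segment, so a single sequence of
    polynomials approximates uniformly in \<open>t\<close>.\<close>
  obtain a b where ab: "{a..b} \<subseteq> I" "spectrum_in A {a..b}" "spectrum_in (A + D) {a..b}"
    using spectrum_in_compact_subinterval[OF A V I specA specV] by blast
  let ?K = "complex_of_real ` {a..b}"
  let ?g = "\<lambda>z. complex_of_real (f (Re z))"
  have g: "continuous_on ?K ?g"
    by (intro continuous_intros continuous_on_compose2[OF f]) (use ab(1) in auto)
  have K: "compact ?K"
    by (intro compact_continuous_image continuous_intros) simp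
  obtain p where p: "uniform_limit ?K (\<lambda>n. poly (p n)) ?g sequentially"
    by (rule complex_polynomials_dense[OF K _ g]) auto
  have lim: "uniform_limit {0..1} (\<lambda>n t. op_poly (A + t *\<^sub>R D) (p n))
      (\<lambda>t. fun_op f (A + t *\<^sub>R D)) sequentially"
  proof (rule uniform_limitI)
    fix e :: real assume e: "e > 0"
    then have "e / 2 > 0" by simp
    from uniform_limitD[OF p this]
    show "\<forall>\<^sub>F n in sequentially. \<forall>t\<in>{0..1}.
        dist (op_poly (A + t *\<^sub>R D) (p n)) (fun_op f (A + t *\<^sub>R D)) < e"
    proof eventually_elim
      case (elim n)
      show ?case
      proof
        fix t :: real assume t: "t \<in> {0..1}"
        have spec: "spectrum (A + t *\<^sub>R D) \<subseteq> ?K"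
          using spectrum_in_segment[OF A D is_interval_cc ab(2,3) t] by (simp add: spectrum_in_def)
        have "norm (fun_op f (A + t *\<^sub>R D) - op_poly (A + t *\<^sub>R D) (p n)) \<le> e / 2"
        proof (rule fun_op_norm_diff_le)
          show "A + t *\<^sub>R D \<in> selfadjoint_ops"
            by (rule selfadjoint_ops_add_scaleR[OF A D])
          show "continuous_on (spectrum (A + t *\<^sub>R D)) ?g"
            by (rule continuous_on_subset[OF g spec])
          show "cmod (?g z - poly (p n) z) \<le> e / 2" if "z \<in> spectrum (A + t *\<^sub>R D)" for z
          proof -
            have "z \<in> ?K"
              using that spec by blast
            then have "dist (poly (p n) z) (?g z) < e / 2"
              using elim by blast
            then show ?thesis
              by (simp add: dist_norm norm_minus_commute)
          qed
        qed (use e in simp)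
        then show "dist (op_poly (A + t *\<^sub>R D) (p n)) (fun_op f (A + t *\<^sub>R D)) < e"
          using e by (simp add: dist_norm norm_minus_commute)
      qed
    qed
  qed
  have "\<forall>\<^sub>F n in sequentially. continuous_on {0..1} (\<lambda>t. op_poly (A + t *\<^sub>R D) (p n))"
    by (intro always_eventually allI continuous_on_op_poly continuous_intros)
  then show ?thesis
    by (rule uniform_limit_theorem[OF _ lim]) simp
qed

section \<open>The Hermite-Hadamard inequality on a subdivision\<close>

lemma integral_reflect_Icc:
  fixes g :: "real \<Rightarrow> real"
  shows "integral {a..b} (\<lambda>x. g (a + b - x)) = integral {a..b} g"
proof -
  have "integral {a..b} (\<lambda>x. g (a + b - x)) = integral {- b..- a} (\<lambda>x. g (a + b + x))"
    using Henstock_Kurzweil_Integration.integral_reflect_real[of b a "\<lambda>x. g (a + b - x)"] by simp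
  also have "\<dots> = integral {a..b} g"
    using integral_shift_real_ivl[of a "a + b" b g] by (simp add: add.commute)
  finally show ?thesis .
qed

text \<open>Symmetrising about the midpoint preserves the integral, and convexity squeezes the
  symmetrised function pointwise between the midpoint value and the mean of the end values.\<close>

lemma convex_integral_bounds:
  fixes g :: "real \<Rightarrow> real"
  assumes g: "convex_on {a..b} g" and cont: "continuous_on {a..b} g" and ab: "a \<le> b"
  shows "(b - a) * g ((a + b) / 2) \<le> integral {a..b} g"
    and "integral {a..b} g \<le> (b - a) * ((g a + g b) / 2)"
proof -
  let ?h = "\<lambda>x. (g x + g (a + b - x)) / 2"
  have refl: "continuous_on {a..b} (\<lambda>x. g (a + b - x))"
    by (intro continuous_on_compose2[OF cont] continuous_intros) auto
  have int: "g integrable_on {a..b}" "(\<lambda>x. g (a + b - x)) integrable_on {a..b}"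
    by (intro integrable_continuous_real cont refl)+
  then have h: "integral {a..b} ?h = integral {a..b} g"
    by (simp add: integral_add integral_reflect_Icc)
  have hint: "?h integrable_on {a..b}"
    by (intro integrable_continuous_real continuous_intros cont refl) simp
  have mid: "g ((a + b) / 2) \<le> ?h x" if "x \<in> {a..b}" for x
  proof -
    have "a + b - x \<in> {a..b}"
      using that by auto
    then show ?thesis
      using convex_onD[OF g, of "1/2" x "a + b - x"] that by (simp add: field_simps)
  qed
  have ends: "?h x \<le> (g a + g b) / 2" if "x \<in> {a..b}" for x
  proof (cases "a = b")
    case False
    with ab have "a < b" by simp
    define t where "t = (x - a) / (b - a)"
    have t: "0 \<le> t" "t \<le> 1"
      using that \<open>a < b\<close> by (simp_all add: t_def)
    have "t * (b - a) = x - a"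
      using \<open>a < b\<close> by (simp add: t_def)
    then have x: "x = (1 - t) * a + t * b" "a + b - x = (1 - t) * b + t * a"
      by algebra+
    have "g ((1 - t) * a + t * b) \<le> (1 - t) * g a + t * g b"
      "g ((1 - t) * b + t * a) \<le> (1 - t) * g b + t * g a"
      using convex_onD[OF g t, of a b] convex_onD[OF g t, of b a] ab by simp_all
    then have "g x \<le> (1 - t) * g a + t * g b" "g (a + b - x) \<le> (1 - t) * g b + t * g a"
      by (simp_all only: x[symmetric])
    then show ?thesis
      by (simp add: algebra_simps)
  qed (use that in simp)
  have "integral {a..b} (\<lambda>_. g ((a + b) / 2)) \<le> integral {a..b} ?h"
    by (intro integral_le hint mid) auto
  then show "(b - a) * g ((a + b) / 2) \<le> integral {a..b} g"
    using ab by (simp only: h) simp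
  have "integral {a..b} ?h \<le> integral {a..b} (\<lambda>_. (g a + g b) / 2)"
    by (intro integral_le hint ends) auto
  then show "integral {a..b} g \<le> (b - a) * ((g a + g b) / 2)"
    using ab by (simp only: h) simp
qed

lemma integral_uniform_subdivision:
  fixes g :: "real \<Rightarrow> real"
  assumes "continuous_on {0..1} g" and n: "n > 0"
  shows "integral {0..1} g = (\<Sum>i<n. integral {real i / n..(real i + 1) / n} g)"
proof -
  have "integral {0..real m / n} g = (\<Sum>i<m. integral {real i / n..(real i + 1) / n} g)"
    if "m \<le> n" for m
    using that
  proof (induction m)
    case (Suc m)
    have "g integrable_on {0..real (Suc m) / n}"
      using Suc.prems n
      by (intro integrable_continuous_real continuous_on_subset[OF assms(1)])
        (auto simp: field_simps intro: order_trans)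
    then have "integral {0..real m / n} g + integral {real m / n..real (Suc m) / n} g
        = integral {0..real (Suc m) / n} g"
      using n by (intro Henstock_Kurzweil_Integration.integral_combine) (auto simp: field_simps)
    then show ?case
      using Suc by (simp add: add.commute)
  qed simp
  from this[of n] show ?thesis
    using n by simp
qed

lemma sum_odd: "(\<Sum>i<n. 2 * real i + 1) = (real n)\<^sup>2"
  by (induction n) (simp_all add: power2_eq_square algebra_simps)

text \<open>The outer inequalities are global, by Jensen with equal weights and by the chord over
  [0, 1]; the inner two are \<open>convex_integral_bounds\<close> summed over the pieces.\<close>

lemma convex_hermite_hadamard_subdivision:
  fixes g :: "real \<Rightarrow> real"
  assumes g: "convex_on {0..1} g" and cont: "continuous_on {0..1} g" and n: "n > 0"
  defines "M \<equiv> (1 / real n) * (\<Sum>i<n. g ((2 * real i + 1) / (2 * real n)))"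
    and "T \<equiv> (1 / (2 * real n)) * (\<Sum>i<n. g ((real i + 1) / real n) + g (real i / real n))"
  shows "g (1 / 2) \<le> M" and "M \<le> integral {0..1} g" and "integral {0..1} g \<le> T"
    and "T \<le> (g 0 + g 1) / 2"
proof -
  have node: "real i / n \<in> {0..1}" "(real i + 1) / n \<in> {0..1}"
      "(2 * real i + 1) / (2 * real n) \<in> {0..1}" "{real i / n..(real i + 1) / n} \<subseteq> {0..1}"
    if "i < n" for i
    using that n by (auto simp: field_simps intro: order_trans)
  \<comment> \<open>The midpoints of the pieces average to 1/2, the argument required by Jensen's
    inequality.\<close>
  have "(\<Sum>i<n. (1 / real n) *\<^sub>R ((2 * real i + 1) / (2 * real n)))
      = (\<Sum>i<n. 2 * real i + 1) / (2 * (real n)\<^sup>2)"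
    by (simp add: sum_divide_distrib power2_eq_square mult_ac)
  also have "\<dots> = 1 / 2"
    using n by (simp add: sum_odd)
  finally have mean: "(\<Sum>i<n. (1 / real n) *\<^sub>R ((2 * real i + 1) / (2 * real n))) = 1 / 2" .
  have "g (\<Sum>i<n. (1 / real n) *\<^sub>R ((2 * real i + 1) / (2 * real n)))
      \<le> (\<Sum>i<n. (1 / real n) * g ((2 * real i + 1) / (2 * real n)))"
    by (rule convex_on_sum[OF _ _ g]) (use n node(3) in auto)
  then show "g (1 / 2) \<le> M"
    unfolding mean M_def by (simp only: sum_distrib_left)
  have piece: "1 / n * g ((2 * real i + 1) / (2 * real n)) \<le> integral {real i / n..(real i + 1) / n} g"
    "integral {real i / n..(real i + 1) / n} g
      \<le> 1 / (2 * real n) * (g ((real i + 1) / n) + g (real i / n))"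
    if "i < n" for i
  proof -
    let ?J = "{real i / n..(real i + 1) / n}"
    have J: "convex_on ?J g" "continuous_on ?J g" "real i / n \<le> (real i + 1) / n"
      using convex_on_subset[OF g node(4)[OF that]] continuous_on_subset[OF cont node(4)[OF that]]
      by (auto simp: divide_right_mono)
    have len: "(real i + 1) / n - real i / n = 1 / n"
      by (simp add: diff_divide_distrib[symmetric])
    have mid: "(real i / n + (real i + 1) / n) / 2 = (2 * real i + 1) / (2 * real n)"
      by (simp add: add_divide_distrib[symmetric] field_simps)
    show "1 / n * g ((2 * real i + 1) / (2 * real n)) \<le> integral ?J g"
      using convex_integral_bounds(1)[OF J] by (simp only: len mid)
    show "integral ?J g \<le> 1 / (2 * real n) * (g ((real i + 1) / n) + g (real i / n))"
      using convex_integral_bounds(2)[OF J] unfolding len by (simp add: add.commute)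
  qed
  show "M \<le> integral {0..1} g" "integral {0..1} g \<le> T"
    unfolding M_def T_def integral_uniform_subdivision[OF cont n] sum_distrib_left
    by (intro sum_mono piece; simp)+
  have chord: "g t \<le> (1 - t) * g 0 + t * g 1" if "t \<in> {0..1}" for t
    using convex_onD[OF g, of t 0 1] that by simp
  \<comment> \<open>The chord at the two ends of piece \<open>i\<close> contributes a multiple of
    \<open>2 i + 1\<close>, so the total is again a sum of odd numbers.\<close>
  have "(\<Sum>i<n. g ((real i + 1) / n) + g (real i / n))
      \<le> (\<Sum>i<n. 2 * g 0 + (2 * real i + 1) * ((g 1 - g 0) / n))"
  proof (rule sum_mono)
    fix i assume "i \<in> {..<n}"
    then have "i < n" by simp
    have "g ((real i + 1) / n) + g (real i / n)
        \<le> ((1 - (real i + 1) / n) * g 0 + (real i + 1) / n * g 1)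
          + ((1 - real i / n) * g 0 + real i / n * g 1)"
      by (intro add_mono chord node \<open>i < n\<close>)
    also have "\<dots> = 2 * g 0 + (2 * real i + 1) * ((g 1 - g 0) / n)"
      using n by (simp add: field_simps)
    finally show "g ((real i + 1) / n) + g (real i / n)
        \<le> 2 * g 0 + (2 * real i + 1) * ((g 1 - g 0) / n)" .
  qed
  also have "\<dots> = real n * (2 * g 0) + (\<Sum>i<n. 2 * real i + 1) * ((g 1 - g 0) / n)"
    by (subst sum.distrib) (simp only: sum_distrib_right sum_constant card_lessThan)
  also have "\<dots> = real n * (g 0 + g 1)"
    using n by (simp only: sum_odd) (simp add: power2_eq_square, simp add: algebra_simps)
  finally show "T \<le> (g 0 + g 1) / 2"
    using n by (simp add: T_def field_simps)
qed

section \<open>Preinvexity along the path\<close>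

text \<open>Condition (C) evaluates \<open>\<eta> Y\<close> only at points reached from
  \<open>Y\<close> in a direction \<open>\<eta> X Y\<close>. With \<open>Y\<close> the point at
  \<open>s\<close>, the point at \<open>u\<close> is reached with \<open>X = A\<close> if
  \<open>u < s\<close> and with \<open>X = B\<close> if \<open>s < u\<close>; both directions are
  multiples of \<open>\<eta> B A\<close>, and the ratio \<open>t\<close> is chosen to land at
  \<open>u\<close>.\<close>

lemma condition_C_path_difference:
  assumes inv: "invex_set \<eta> S" and C: "condition_C \<eta> S" and A: "A \<in> S" and B: "B \<in> S"
    and s: "s \<in> {0..1}" and u: "u \<in> {0..1}"
  shows "\<eta> (A + s *\<^sub>R \<eta> B A) (A + u *\<^sub>R \<eta> B A) = (s - u) *\<^sub>R \<eta> B A"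
proof -
  define P where "P r = A + r *\<^sub>R \<eta> B A" for r
  have P: "P r \<in> S" if "r \<in> {0..1}" for r
    using inv A B that by (auto simp: invex_set_def P_def)
  have C1: "\<eta> Y (Y + t *\<^sub>R \<eta> X Y) = - (t *\<^sub>R \<eta> X Y)"
    and C2: "\<eta> X (Y + t *\<^sub>R \<eta> X Y) = (1 - t) *\<^sub>R \<eta> X Y"
    if "X \<in> S" "Y \<in> S" "t \<in> {0..1}" for X Y t
    using C that by (auto simp: condition_C_def)
  \<comment> \<open>Strict order makes the later denominators \<open>s\<close> and
    \<open>1 - s\<close> nonzero; for \<open>s = u\<close>, condition (C) at \<open>t = 0\<close>
    gives the value 0.\<close>
  consider "s = u" "s < 1" | "u < s" | "s < u" | "s = 1" "u = 1"
    using s u by fastforce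
  then have "\<eta> (P s) (P u) = (s - u) *\<^sub>R \<eta> B A"
  proof cases
    case 2
    have As: "\<eta> A (P s) = - (s *\<^sub>R \<eta> B A)"
      unfolding P_def by (rule C1[OF B A s])
    define t where "t = (s - u) / s"
    have t: "t \<in> {0..1}" "t * s = s - u"
      using 2 s u by (auto simp: t_def)
    have "P s + t *\<^sub>R \<eta> A (P s) = P u"
      by (simp only: As scaleR_minus_right scaleR_scaleR t(2)) (simp add: P_def algebra_simps)
    then show ?thesis
      using C1[OF A P[OF s] t(1)] t(2) by (simp add: As)
  next
    case 4
    show ?thesis
      using C1[OF A P[of 1], of 0] 4 by simp
  next
    case 1
    then show ?thesis
      using C1[OF B P[OF s], of 0] by simp
  next
    case 3
    have Bs: "\<eta> B (P s) = (1 - s) *\<^sub>R \<eta> B A"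
      unfolding P_def by (rule C2[OF B A s])
    define t where "t = (u - s) / (1 - s)"
    have t: "t \<in> {0..1}" "t * (1 - s) = u - s"
      using 3 s u by (auto simp: t_def)
    have "P s + t *\<^sub>R \<eta> B (P s) = P u"
      by (simp only: Bs scaleR_scaleR t(2)) (simp add: P_def algebra_simps)
    then have "\<eta> (P s) (P u) = - ((u - s) *\<^sub>R \<eta> B A)"
      using C1[OF B P[OF s] t(1)] by (simp only: Bs scaleR_scaleR t(2))
    then show ?thesis
      by (simp add: algebra_simps)
  qed
  then show ?thesis
    by (simp add: P_def)
qed

lemma op_le_iff_inner:
  "A \<le>\<^sub>o\<^sub>p B \<longleftrightarrow> (\<forall>x. blinfun_apply A x \<bullet> x \<le> blinfun_apply B x \<bullet> x)"
  by (simp add: op_le_def inner_eq_Re_cinner)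

text \<open>The step from \<open>u\<close> in the direction \<open>\<eta> (P s) (P u)\<close> is an
  affine step in the parameter. Preinvexity covers only pairs with spectra in \<open>I\<close>,
  hence the assumption on all \<open>t\<close>.\<close>

lemma preinvex_convex_on_path:
  assumes inv: "invex_set \<eta> S" and C: "condition_C \<eta> S" and A: "A \<in> S" and B: "B \<in> S"
    and pre: "operator_preinvex I \<eta> (eta_path \<eta> A B) f"
    and spec: "\<And>t. t \<in> {0..1} \<Longrightarrow> spectrum_in (A + t *\<^sub>R \<eta> B A) I"
  shows "convex_on {0..1} (\<lambda>t. blinfun_apply (fun_op f (A + t *\<^sub>R \<eta> B A)) x \<bullet> x)"
proof (rule convex_onI)
  define P where "P r = A + r *\<^sub>R \<eta> B A" for r
  fix t u s :: real
  assume t: "0 < t" "t < 1" and u: "u \<in> {0..1}" and s: "s \<in> {0..1}"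
  have "preinvex_ineq \<eta> f (P s) (P u)"
    using pre s u spec unfolding operator_preinvex_def eta_path_def P_def by blast
  then have le: "fun_op f (P u + t *\<^sub>R \<eta> (P s) (P u)) \<le>\<^sub>o\<^sub>p
      (1 - t) *\<^sub>R fun_op f (P u) + t *\<^sub>R fun_op f (P s)"
    using t by (simp add: preinvex_ineq_def)
  have "\<eta> (P s) (P u) = (s - u) *\<^sub>R \<eta> B A"
    unfolding P_def by (rule condition_C_path_difference[OF inv C A B s u])
  then have eq: "P u + t *\<^sub>R \<eta> (P s) (P u) = P ((1 - t) *\<^sub>R u + t *\<^sub>R s)"
    by (simp only:) (simp add: P_def algebra_simps)
  show "blinfun_apply (fun_op f (A + ((1 - t) *\<^sub>R u + t *\<^sub>R s) *\<^sub>R \<eta> B A)) x \<bullet> x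
      \<le> (1 - t) * (blinfun_apply (fun_op f (A + u *\<^sub>R \<eta> B A)) x \<bullet> x)
        + t * (blinfun_apply (fun_op f (A + s *\<^sub>R \<eta> B A)) x \<bullet> x)"
    using le unfolding eq
    by (simp add: op_le_iff_inner P_def blinfun.add_left blinfun.scaleR_left inner_add_left)
qed simp

theorem theorem3p1:
  fixes I :: "real set" and f :: "real \<Rightarrow> real"
    and S :: "'a::complex_hilbert_space operator set"
    and \<eta> :: "'a operator \<Rightarrow> 'a operator \<Rightarrow> 'a operator"
    and k p :: nat and A B :: "'a operator"
  assumes "is_interval I"
    and "S \<subseteq> selfadjoint_ops"
    and "\<And>X Y. X \<in> S \<Longrightarrow> Y \<in> S \<Longrightarrow> \<eta> X Y \<in> selfadjoint_ops"
    and "invex_set \<eta> S"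
    and "condition_C \<eta> S"
    and "\<And>A B. A \<in> S \<Longrightarrow> B \<in> S \<Longrightarrow> spectrum_in A I \<Longrightarrow> spectrum_in (A + \<eta> B A) I \<Longrightarrow>
           operator_preinvex I \<eta> (eta_path \<eta> A B) f"
    and "k > 0" and "p > 0"
    and "A \<in> S" and "B \<in> S" and "spectrum_in A I" and "spectrum_in (A + \<eta> B A) I"
  shows "let F = (\<lambda>t. fun_op f (A + t *\<^sub>R \<eta> B A));
             n = real (k^p);
             midpoint_sum = (1/n) *\<^sub>R (\<Sum>i = 0..k^p - 1. F ((2 * real i + 1) / (2 * n)));
             trapezoid_sum = (1 / (2 * n)) *\<^sub>R
               (\<Sum>i = 0..k^p - 1. F ((real i + 1) / n) + F (real i / n))
         in F (1/2) \<le>\<^sub>o\<^sub>p midpoint_sum \<and>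
            midpoint_sum \<le>\<^sub>o\<^sub>p integral {0..1} F \<and>
            integral {0..1} F \<le>\<^sub>o\<^sub>p trapezoid_sum \<and>
            trapezoid_sum \<le>\<^sub>o\<^sub>p (1/2) *\<^sub>R (fun_op f A + fun_op f (A + \<eta> B A)) \<and>
            (spectrum_in B I \<and> preinvex_ineq \<eta> f B A \<longrightarrow>
               trapezoid_sum \<le>\<^sub>o\<^sub>p (1/2) *\<^sub>R (fun_op f A + fun_op f B))"
proof -
  define D where "D = \<eta> B A"
  define F where "F t = fun_op f (A + t *\<^sub>R D)" for t
  define n where "n = k ^ p"
  define M where "M = (1 / real n) *\<^sub>R (\<Sum>i<n. F ((2 * real i + 1) / (2 * real n)))"
  define T where "T = (1 / (2 * real n)) *\<^sub>R
    (\<Sum>i<n. F ((real i + 1) / real n) + F (real i / real n))"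
  have n: "n > 0"
    using \<open>k > 0\<close> by (simp add: n_def)
  \<comment> \<open>\<open>n - 1\<close> is a natural number subtraction, so the index sets agree
    because \<open>n > 0\<close>.\<close>
  then have index: "{0..n - 1} = {..<n}"
    by auto
  have A: "A \<in> selfadjoint_ops" and D: "D \<in> selfadjoint_ops"
    using assms(2,3,9,10) by (auto simp: D_def)
  have pre: "operator_preinvex I \<eta> (eta_path \<eta> A B) f"
    by (intro assms)
  have specV: "spectrum_in (A + D) I"
    using assms(12) by (simp add: D_def)
  have spec: "spectrum_in (A + t *\<^sub>R D) I" if "t \<in> {0..1}" for t
    by (rule spectrum_in_segment[OF A D assms(1) assms(11) specV that])
  have cont: "continuous_on {0..1} F"
    unfolding F_def
    using pre by (intro continuous_on_fun_op_segment[OF A D assms(1) assms(11) specV])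
      (simp add: operator_preinvex_def)
  define g where "g x t = blinfun_apply (F t) x \<bullet> x" for x t
  have convex: "convex_on {0..1} (g x)" for x
    unfolding g_def F_def D_def
    by (rule preinvex_convex_on_path[OF assms(4,5,9,10) pre]) (rule spec[unfolded D_def])
  \<comment> \<open>A bounded linear functional commutes with the operator-valued integral, which
    reduces its quadratic form to a scalar integral.\<close>
  have lin: "bounded_linear (\<lambda>X. blinfun_apply X x \<bullet> x)" for x :: 'a
    by (intro bounded_linear_intros)
  have gcont: "continuous_on {0..1} (g x)" for x
    unfolding g_def by (intro continuous_intros cont)
  have int: "blinfun_apply (integral {0..1} F) x \<bullet> x = integral {0..1} (g x)" for x
    using integral_linear[OF integrable_continuous_real[OF cont] lin[of x]]
    by (simp add: o_def g_def[abs_def])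
  have sum_apply: "blinfun_apply (r *\<^sub>R (\<Sum>i<n. X i)) x \<bullet> x = r * (\<Sum>i<n. blinfun_apply (X i) x \<bullet> x)"
    for r :: real and X :: "nat \<Rightarrow> 'a operator" and x
    by (simp add: blinfun.scaleR_left blinfun.sum_left inner_sum_left)
  have M: "blinfun_apply M x \<bullet> x = (1 / real n) * (\<Sum>i<n. g x ((2 * real i + 1) / (2 * real n)))"
    and T: "blinfun_apply T x \<bullet> x = (1 / (2 * real n)) *
      (\<Sum>i<n. g x ((real i + 1) / real n) + g x (real i / real n))" for x
    unfolding M_def T_def sum_apply g_def by (simp_all add: blinfun.add_left inner_add_left)
  note HH = convex_hermite_hadamard_subdivision[OF convex gcont n]
  have "F (1 / 2) \<le>\<^sub>o\<^sub>p M" "M \<le>\<^sub>o\<^sub>p integral {0..1} F" "integral {0..1} F \<le>\<^sub>o\<^sub>p T"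
    unfolding op_le_iff_inner M T int using HH(1-3) by (auto simp: g_def)
  moreover have end_point: "T \<le>\<^sub>o\<^sub>p (1 / 2) *\<^sub>R (fun_op f A + fun_op f (A + D))"
    unfolding op_le_iff_inner T using HH(4)
    by (simp add: g_def F_def blinfun.scaleR_left blinfun.add_left inner_add_left)
  moreover have "T \<le>\<^sub>o\<^sub>p (1 / 2) *\<^sub>R (fun_op f A + fun_op f B)" if "preinvex_ineq \<eta> f B A"
  proof -
    \<comment> \<open>The preinvexity inequality at \<open>t = 1\<close>, where the weight of f(A)
      vanishes.\<close>
    have "fun_op f (A + D) \<le>\<^sub>o\<^sub>p fun_op f B"
      using that by (auto simp: preinvex_ineq_def D_def dest!: bspec[of _ _ 1])
    then have "blinfun_apply (fun_op f (A + D)) x \<bullet> x \<le> blinfun_apply (fun_op f B) x \<bullet> x" for x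
      by (simp add: op_le_iff_inner)
    moreover have "blinfun_apply T x \<bullet> x
        \<le> (blinfun_apply (fun_op f A) x \<bullet> x + blinfun_apply (fun_op f (A + D)) x \<bullet> x) / 2" for x
      using end_point
      by (simp add: op_le_iff_inner blinfun.scaleR_left blinfun.add_left inner_add_left)
    ultimately have "blinfun_apply T x \<bullet> x
        \<le> (blinfun_apply (fun_op f A) x \<bullet> x + blinfun_apply (fun_op f B) x \<bullet> x) / 2" for x
      by (smt (verit) divide_right_mono)
    then show ?thesis
      by (simp add: op_le_iff_inner blinfun.scaleR_left blinfun.add_left inner_add_left)
  qed
  ultimately show ?thesis
    unfolding Let_def n_def[symmetric] index M_def T_def F_def D_def by blast
qed


end
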